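(* Let $X$ be an arbitrary real Banach space (of dimension at least $2$). Then $$\lambda_X^-(r) \le 1-\sqrt{1-r^2} \le \lambda_X^+(r) \quad \text{for all } r\in[0,1],$$ where moreover $1-\sqrt{1-r^2}=\lambda_H^-(r)=\lambda_H^+(r)$ for every real Hilbert space $H$ of dimension at least $2$. If at least one of these inequalities turns into equality, i.e. if $\lambda_X^-(r)=1-\sqrt{1-r^2}$ for all $r\in[0,1]$ or $\lambda_X^+(r)=1-\sqrt{1-r^2}$ for all $r\in[0,1]$, then $X$ is a Hilbert space (its norm is induced by an inner product).
   Context: Let $X$ be a real Banach space with $\dim X \ge 2$. Write $S_X=\{x\in X:\|x\|=1\}$. For $x\in X\setminus\{0\}$ and $y\in X$, $y$ is quasiorthogonal to $x$, written $y\urcorner x$, if there is a functional $p\in X^*$ with $\|p\|=1$, $p(x)=\|x\|$ and $p(y)=0$. For $x,y\in S_X$ with $y\urcorner x$ and $r\in[0,1]$ put $\lambda_X(x,y,r)=\min\{\lambda\in\mathbb{R}:\ \|x+ry-\lambda x\|=1\}$. The modulus of supporting convexity and the modulus of supporting smoothness are, for $r\in[0,1]$, $$\lambda_X^-(r)=\inf\{\lambda_X(x,y,r):\ x,y\in S_X,\ y\urcorner x\},$$ $$\lambda_X^+(r)=\sup\{\lambda_X(x,y,t):\ x,y\in S_X,\ y\urcorner x,\ 0\le t\le r\}.$$ *)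

theory Defs
  imports "HOL-Analysis.Analysis"
begin

text \<open>\<open>quasiorthogonal y x\<close> is the relation \<open>y \<urcorner> x\<close>.\<close>

definition quasiorthogonal :: "'a::real_normed_vector \<Rightarrow> 'a \<Rightarrow> bool" where
  "quasiorthogonal y x \<longleftrightarrow>
     x \<noteq> 0 \<and> (\<exists>p :: 'a \<Rightarrow>\<^sub>L real. norm p = 1 \<and> blinfun_apply p x = norm x \<and> blinfun_apply p y = 0)"

text \<open>For unit vectors with \<open>quasiorthogonal y x\<close> and \<open>r \<in> {0..1}\<close> the minimum is attained in \<open>{0..1}\<close>:
  the norm is continuous in \<open>l\<close>, at least \<open>1\<close> at \<open>l = 0\<close>, equal to \<open>r\<close> at \<open>l = 1\<close>, and at least
  \<open>1 - l > 1\<close> for \<open>l < 0\<close>.\<close>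

definition supp_lambda :: "'a::real_normed_vector \<Rightarrow> 'a \<Rightarrow> real \<Rightarrow> real" where
  "supp_lambda x y r = (LEAST l. norm (x + r *\<^sub>R y - l *\<^sub>R x) = 1)"

definition supp_convexity_modulus :: "'a::real_normed_vector itself \<Rightarrow> real \<Rightarrow> real" where
  "supp_convexity_modulus TYPE('a) r =
     Inf {supp_lambda x y r | x y :: 'a. x \<in> sphere 0 1 \<and> y \<in> sphere 0 1 \<and> quasiorthogonal y x}"

definition supp_smoothness_modulus :: "'a::real_normed_vector itself \<Rightarrow> real \<Rightarrow> real" where
  "supp_smoothness_modulus TYPE('a) r =
     Sup {supp_lambda x y t | (x :: 'a) y t.
            x \<in> sphere 0 1 \<and> y \<in> sphere 0 1 \<and> quasiorthogonal y x \<and> 0 \<le> t \<and> t \<le> r}"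

definition is_inner_product :: "('a::real_vector \<Rightarrow> 'a \<Rightarrow> real) \<Rightarrow> bool" where
  "is_inner_product B \<longleftrightarrow>
     bilinear B \<and> (\<forall>x y. B x y = B y x) \<and> (\<forall>x. 0 \<le> B x x) \<and> (\<forall>x. B x x = 0 \<longleftrightarrow> x = 0)"

text \<open>Being a Hilbert space is stated as a property of a given Banach space rather than by the class
  \<open>real_inner\<close>, because it has to be derivable for a type that is only known to be in \<open>banach\<close>.
  Completeness is part of the sort.\<close>

definition is_hilbert_space :: "'a::banach itself \<Rightarrow> bool" where
  "is_hilbert_space TYPE('a) \<longleftrightarrow>
     (\<exists>B :: 'a \<Rightarrow> 'a \<Rightarrow> real. is_inner_product B \<and> (\<forall>x. norm x = sqrt (B x x)))"

lemma is_hilbert_space_real_inner: "is_hilbert_space TYPE('a::{real_inner, banach})"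
proof -
  have "is_inner_product (inner :: 'a \<Rightarrow> 'a \<Rightarrow> real)"
    by (auto simp: is_inner_product_def bilinear_def inner_commute
        intro!: bounded_linear.linear bounded_linear_inner_left bounded_linear_inner_right)
  then show ?thesis
    unfolding is_hilbert_space_def using norm_eq_sqrt_inner by blast
qed

text \<open>The library's \<open>dim\<close> is \<open>0\<close> on infinite-dimensional spaces, so it cannot be used here.\<close>

definition dim_ge_2 :: "'a::real_vector itself \<Rightarrow> bool" where
  "dim_ge_2 TYPE('a) \<longleftrightarrow> (\<exists>B :: 'a set. independent B \<and> card B = 2)"

end

theory Submission
  imports Defs
begin

text \<open>For quasiorthogonal unit vectors \<open>y \<urcorner> x\<close> the number \<open>1 - \<lambda>(x, y, r)\<close> is the largest \<open>m\<close> with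
  \<open>\<parallel>m x + r y\<parallel> = 1\<close>. Put \<open>\<mu> = sqrt (1 - r\<^sup>2)\<close>. For \<open>r < 1\<close> the two inequalities therefore say that some pair
  satisfies \<open>\<parallel>\<mu> x + r y\<parallel> \<le> 1\<close> and some pair satisfies \<open>\<parallel>\<mu> x + r y\<parallel> \<ge> 1\<close>.

  Both follow from an area computation in one plane with unit disc \<open>K\<close>. As \<open>x\<close> runs once round the
  boundary of \<open>K\<close>, the segments from \<open>\<mu> x\<close> to \<open>\<mu> x + r y\<close>, tangent to \<open>\<mu> K\<close>, sweep out a region. Moving
  each segment back to the origin turns this region into \<open>r K\<close>, so its area is \<open>r\<^sup>2 |K|\<close> (Mamikon's theorem),
  and together with \<open>\<mu> K\<close> it has area \<open>(\<mu>\<^sup>2 + r\<^sup>2) |K| = |K|\<close>. If all the points \<open>\<mu> x + r y\<close> were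
  uniformly outside \<open>K\<close>, the region together with \<open>\<mu> K\<close> would cover a larger copy of \<open>K\<close>; if they were
  uniformly inside, it would fit into a smaller copy. Both are impossible. The boundary of \<open>K\<close> need not be
  smooth, so \<open>x\<close> runs through a finite net \<open>V\<close> of the unit circle: the sectors of \<open>r K\<close> cut out by the normal
  cones of \<open>V\<close> are translated rigidly (\<open>measure_moved_sectors\<close>), which makes the area exact, and the net
  only makes the tangency approximate. A compactness argument
  (\<open>birkhoff_pair_limit\<close>) then produces an exact pair.

  If one of the moduli is that of a Hilbert space, then \<open>\<parallel>a x + b y\<parallel>\<^sup>2\<close> is at least (or at most) \<open>a\<^sup>2 + b\<^sup>2\<close>
  for all \<open>a\<close>, \<open>b\<close> and every pair: for each pair, the unit disc of the plane lies inside (or contains) the ellipse with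
  conjugate half-axes \<open>x\<close>, \<open>y\<close>. Two pairs in the same plane can each be expressed in coordinates of
  the other; comparing the two ellipses forces the second vector of either pair onto the
  ellipse of the other one (\<open>sum_squares_eq_1_if_norm_ge\<close>, \<open>sum_squares_eq_1_if_norm_le\<close>). Every unit vector of the
  plane is such a second vector, so every plane is Euclidean, and the argument of Jordan and von Neumann gives
  the inner product.

  Quasiorthogonality speaks about functionals on the whole space. By the Hahn-Banach theorem it is the
  condition \<open>\<parallel>x + t y\<parallel> \<ge> 1\<close> for all \<open>t\<close> (Birkhoff orthogonality), which only involves the plane of \<open>x\<close>
  and \<open>y\<close>.\<close>

section \<open>The Hahn-Banach theorem and Birkhoff orthogonality\<close>

definition sublinear :: "('a::real_vector \<Rightarrow> real) \<Rightarrow> bool" where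
  "sublinear q \<longleftrightarrow> (\<forall>x y. q (x + y) \<le> q x + q y) \<and> (\<forall>c x. 0 < c \<longrightarrow> q (c *\<^sub>R x) = c * q x) \<and> q 0 = 0"

lemma sublinear_add: "sublinear q \<Longrightarrow> q (x + y) \<le> q x + q y"
  and sublinear_scaleR: "sublinear q \<Longrightarrow> 0 < c \<Longrightarrow> q (c *\<^sub>R x) = c * q x"
  and sublinear_0: "sublinear q \<Longrightarrow> q 0 = 0"
  by (auto simp: sublinear_def)

lemma sublinear_ge_minus: "sublinear q \<Longrightarrow> - q (- x) \<le> q x"
  using sublinear_add[of q x "- x"] sublinear_0[of q] by simp

lemma sublinearI:
  assumes "\<And>x y. q (x + y) \<le> q x + q y" "\<And>c x. 0 < c \<Longrightarrow> q (c *\<^sub>R x) \<le> c * q x" "q 0 = 0"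
  shows "sublinear q"
proof -
  have "q (c *\<^sub>R x) = c * q x" if "0 < c" for c x
  proof (rule antisym)
    have "q ((1/c) *\<^sub>R c *\<^sub>R x) \<le> (1/c) * q (c *\<^sub>R x)"
      using that by (intro assms) auto
    then show "c * q x \<le> q (c *\<^sub>R x)"
      using that by (simp add: field_simps)
  qed (use assms that in auto)
  then show ?thesis
    using assms by (auto simp: sublinear_def)
qed

text \<open>The infimum of \<open>q (z + w) - c\<close> over \<open>(w, c) \<in> G\<close> is sublinear because \<open>G\<close> is a convex cone. The single
  construction serves twice: to prescribe the values of a functional on a plane, and to show that minimal
  sublinear functionals are linear.\<close>

lemma sublinear_below_on_cone:
  fixes q :: "'a::real_vector \<Rightarrow> real"
  assumes q: "sublinear q"
    and zero: "(0, 0) \<in> G"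
    and add: "\<And>v c w d. (v, c) \<in> G \<Longrightarrow> (w, d) \<in> G \<Longrightarrow> (v + w, c + d) \<in> G"
    and scale: "\<And>s w c. 0 < s \<Longrightarrow> (w, c) \<in> G \<Longrightarrow> (s *\<^sub>R w, s * c) \<in> G"
    and le: "\<And>w c. (w, c) \<in> G \<Longrightarrow> c \<le> q w"
  obtains q' where "sublinear q'" "\<And>x. q' x \<le> q x" "\<And>w c. (w, c) \<in> G \<Longrightarrow> q' (- w) \<le> - c"
proof
  define q' where "q' z = (INF g\<in>G. q (z + fst g) - snd g)" for z
  have bdd: "bdd_below ((\<lambda>g. q (z + fst g) - snd g) ` G)" for z
  proof (rule bdd_belowI2)
    fix g assume "g \<in> G"
    then have "snd g \<le> q (fst g)" using le[of "fst g" "snd g"] by simp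
    then show "- q (- z) \<le> q (z + fst g) - snd g"
      using sublinear_add[OF q, of "z + fst g" "- z"] by simp
  qed
  have upper: "q' z \<le> q (z + w) - c" if "(w, c) \<in> G" for z w c
    unfolding q'_def using cINF_lower[OF bdd that] by simp
  have lower: "m \<le> q' z" if "\<And>w c. (w, c) \<in> G \<Longrightarrow> m \<le> q (z + w) - c" for m z
    unfolding q'_def using zero that by (intro cINF_greatest) auto
  show "sublinear q'"
  proof (rule sublinearI)
    fix x y
    have "q' (x + y) - (q (x + v) - c) \<le> q' y" if vc: "(v, c) \<in> G" for v c
    proof (rule lower)
      fix w d assume "(w, d) \<in> G"
      then have "q' (x + y) \<le> q (x + y + (v + w)) - (c + d)"
        by (intro upper add vc)
      also have "\<dots> \<le> q (x + v) + q (y + w) - (c + d)"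
        using sublinear_add[OF q, of "x + v" "y + w"] by (simp add: algebra_simps)
      finally show "q' (x + y) - (q (x + v) - c) \<le> q (y + w) - d" by simp
    qed
    then have "q' (x + y) - q' y \<le> q' x"
      by (intro lower) (smt (verit))
    then show "q' (x + y) \<le> q' x + q' y" by simp
  next
    fix s :: real and x assume s: "0 < s"
    have "q' (s *\<^sub>R x) / s \<le> q' x"
    proof (rule lower)
      fix w c assume "(w, c) \<in> G"
      then have "q' (s *\<^sub>R x) \<le> q (s *\<^sub>R x + s *\<^sub>R w) - s * c"
        by (intro upper scale s)
      also have "\<dots> = s * (q (x + w) - c)"
        using sublinear_scaleR[OF q s, of "x + w"] by (simp add: algebra_simps)
      finally show "q' (s *\<^sub>R x) / s \<le> q (x + w) - c"
        using s by (simp add: field_simps)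
    qed
    then show "q' (s *\<^sub>R x) \<le> s * q' x"
      using s by (simp add: field_simps)
  next
    show "q' 0 = 0"
      using upper[OF zero, of 0] lower[of 0 0] le sublinear_0[OF q] by force
  qed
  show "q' x \<le> q x" for x
    using upper[OF zero, of x] by simp
  show "q' (- w) \<le> - c" if "(w, c) \<in> G" for w c
    using upper[OF that, of "- w"] sublinear_0[OF q] by simp
qed

lemma sublinear_minimal_exists:
  fixes n :: "'a::real_vector \<Rightarrow> real"
  assumes n: "sublinear n"
  obtains q where "sublinear q" "\<And>x. q x \<le> n x"
    "\<And>q'. sublinear q' \<Longrightarrow> (\<And>x. q' x \<le> q x) \<Longrightarrow> q' = q"
proof -
  define A where "A = {q. sublinear q \<and> (\<forall>x. q x \<le> n x)}"
  define P :: "('a \<Rightarrow> real) \<Rightarrow> ('a \<Rightarrow> real) \<Rightarrow> bool" where "P p q \<longleftrightarrow> (\<forall>x. q x \<le> p x)" for p q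
  have "\<exists>m\<in>A. \<forall>a\<in>A. P m a \<longrightarrow> a = m"
  proof (rule predicate_Zorn)
    show "partial_order_on A (relation_of P A)"
      by (rule partial_order_on_relation_ofI)
        (auto simp: P_def intro: order_trans intro!: ext order_antisym)
  next
    fix C assume "C \<in> Chains (relation_of P A)"
    then have CA: "\<And>q. q \<in> C \<Longrightarrow> q \<in> A"
      and chain: "\<And>p q. p \<in> C \<Longrightarrow> q \<in> C \<Longrightarrow> P p q \<or> P q p"
      by (auto simp: Chains_def relation_of_def)
    show "\<exists>u\<in>A. \<forall>a\<in>C. P a u"
    proof (cases "C = {}")
      case True
      then show ?thesis using n by (auto simp: A_def)
    next
      case False
      define u where "u x = (INF q\<in>C. q x)" for x
      have sub: "sublinear q" and below: "q x \<le> n x" if "q \<in> C" for q x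
        using CA[OF that] by (auto simp: A_def)
      have bdd: "bdd_below ((\<lambda>q. q x) ` C)" for x
        using sublinear_ge_minus[OF sub, of _ x] below[of _ "- x"]
        by (intro bdd_belowI2[of _ "- n (- x)"]) (smt (verit))
      have upper: "u x \<le> q x" if "q \<in> C" for q x
        unfolding u_def using bdd that by (rule cINF_lower)
      have lower: "m \<le> u x" if "\<And>q. q \<in> C \<Longrightarrow> m \<le> q x" for m x
        unfolding u_def using False that by (rule cINF_greatest)
      have "sublinear u"
      proof (rule sublinearI)
        fix x y
        have "u (x + y) \<le> p x + q y" if pq: "p \<in> C" "q \<in> C" for p q
        proof -
          obtain r where "r \<in> C" "r x \<le> p x" "r y \<le> q y"
            using chain[OF pq] pq unfolding P_def by blast
          then show ?thesis
            using upper[of r "x + y"] sublinear_add[OF sub, of r x y] by linarith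
        qed
        then have "u (x + y) - p x \<le> u y" if "p \<in> C" for p
          using that by (intro lower) (smt (verit))
        then have "u (x + y) - u y \<le> u x"
          by (intro lower) (smt (verit))
        then show "u (x + y) \<le> u x + u y" by simp
      next
        fix c :: real and x assume c: "0 < c"
        have "u (c *\<^sub>R x) / c \<le> u x"
        proof (rule lower)
          fix q assume "q \<in> C"
          then show "u (c *\<^sub>R x) / c \<le> q x"
            using upper[of q "c *\<^sub>R x"] sublinear_scaleR[OF sub c, of q x] c by (simp add: field_simps)
        qed
        then show "u (c *\<^sub>R x) \<le> c * u x" using c by (simp add: field_simps)
      next
        show "u 0 = 0"
          using False by (simp add: u_def sublinear_0[OF sub] cong: INF_cong)
      qed
      moreover have "u x \<le> n x" for x
        using False upper below by (meson ex_in_conv order_trans)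
      ultimately show ?thesis
        using upper by (auto simp: A_def P_def)
    qed
  qed
  then obtain m where m: "m \<in> A" "\<And>a. a \<in> A \<Longrightarrow> P m a \<Longrightarrow> a = m" by blast
  show ?thesis
  proof (rule that)
    show "q' = m" if "sublinear q'" "\<And>x. q' x \<le> m x" for q'
      using m that by (auto simp: A_def P_def intro: order_trans)
  qed (use m in \<open>auto simp: A_def\<close>)
qed

text \<open>A minimal sublinear functional \<open>q\<close> is linear: lowering \<open>q\<close> along the ray spanned by \<open>v\<close> changes nothing, which
  forces \<open>q (- v) = - q v\<close>, and oddness turns subadditivity into additivity.\<close>

theorem hahn_banach_sublinear:
  fixes n :: "'a::real_vector \<Rightarrow> real"
  assumes "sublinear n"
  obtains p where "linear p" "\<And>x. p x \<le> n x"
proof -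
  obtain q where q: "sublinear q" "\<And>x. q x \<le> n x"
    and min: "\<And>q'. sublinear q' \<Longrightarrow> (\<And>x. q' x \<le> q x) \<Longrightarrow> q' = q"
    using sublinear_minimal_exists[OF assms] by metis
  have le: "q (- v) \<le> - q v" for v
  proof -
    \<comment> \<open>lowering \<open>q\<close> along this ray makes its value at \<open>- v\<close> at most \<open>- q v\<close>\<close>
    define G where "G = {(t *\<^sub>R v, t * q v) | t. 0 \<le> t}"
    have le: "c \<le> q w" if "(w, c) \<in> G" for w c
    proof -
      from that obtain t where t: "w = t *\<^sub>R v" "c = t * q v" "0 \<le> t"
        by (auto simp: G_def)
      then show ?thesis
        using sublinear_scaleR[OF q(1), of t v] sublinear_0[OF q(1)] by (cases "t = 0") auto
    qed
    have zero: "(0, 0) \<in> G" by (force simp: G_def)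
    have add: "(x + y, c + d) \<in> G" if "(x, c) \<in> G" "(y, d) \<in> G" for x y c d
      using that unfolding G_def
      by clarsimp (metis add_nonneg_nonneg distrib_right scaleR_add_left)
    have scale: "(s *\<^sub>R y, s * d) \<in> G" if "0 < s" "(y, d) \<in> G" for s y d
      using that unfolding G_def
      by clarsimp (metis less_eq_real_def mult.assoc mult_nonneg_nonneg)
    obtain q' where q': "sublinear q'" "\<And>x. q' x \<le> q x"
      "\<And>w c. (w, c) \<in> G \<Longrightarrow> q' (- w) \<le> - c"
      using sublinear_below_on_cone[OF q(1) zero add scale le] by blast
    moreover have "(v, q v) \<in> G" by (force simp: G_def intro: exI[of _ 1])
    ultimately show ?thesis using min[OF q'(1,2)] by auto
  qed
  then have minus: "q (- v) = - q v" for v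
    using sublinear_ge_minus[OF q(1), of v] le[of v] by linarith
  have "linear q"
  proof (rule linearI)
    show "q (x + y) = q x + q y" for x y
      using sublinear_add[OF q(1), of x y] sublinear_add[OF q(1), of "x + y" "- y"] minus[of y]
      by simp
    show "q (c *\<^sub>R x) = c *\<^sub>R q x" for c x
    proof (cases c "0 :: real" rule: linorder_cases)
      case less
      then show ?thesis
        using sublinear_scaleR[OF q(1), of "- c" x] minus[of "c *\<^sub>R x"] by simp
    qed (use sublinear_scaleR[OF q(1)] sublinear_0[OF q(1)] in auto)
  qed
  then show ?thesis using that q by blast
qed

text \<open>On the plane of \<open>x\<close> and \<open>y\<close> the functional is \<open>\<alpha> x + \<beta> y \<mapsto> \<alpha>\<close>, and the metric condition says exactly that it is
  dominated by the norm. The set \<open>G\<close> below is its graph.\<close>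

lemma quasiorthogonal_iff_birkhoff:
  fixes x y :: "'a::real_normed_vector"
  assumes "norm x = 1"
  shows "quasiorthogonal y x \<longleftrightarrow> (\<forall>t. 1 \<le> norm (x + t *\<^sub>R y))"
proof
  assume "quasiorthogonal y x"
  then obtain p :: "'a \<Rightarrow>\<^sub>L real" where p: "norm p = 1" "blinfun_apply p x = 1" "blinfun_apply p y = 0"
    using assms by (auto simp: quasiorthogonal_def)
  show "\<forall>t. 1 \<le> norm (x + t *\<^sub>R y)"
  proof
    fix t
    have "blinfun_apply p (x + t *\<^sub>R y) = 1"
      using p by (simp add: blinfun.add_right blinfun.scaleR_right)
    then show "1 \<le> norm (x + t *\<^sub>R y)"
      using norm_blinfun[of p "x + t *\<^sub>R y"] p by simp
  qed
next
  assume birkhoff: "\<forall>t. 1 \<le> norm (x + t *\<^sub>R y)"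
  define G where "G = {(\<alpha> *\<^sub>R x + \<beta> *\<^sub>R y, \<alpha>) | \<alpha> \<beta>. True}"
  have sub: "sublinear (norm :: 'a \<Rightarrow> real)"
    by (rule sublinearI) (auto simp: norm_triangle_ineq)
  have le: "c \<le> norm w" if wc: "(w, c) \<in> G" for w c
  proof (cases "c > 0")
    case True
    from wc obtain \<beta> where w: "w = c *\<^sub>R x + \<beta> *\<^sub>R y"
      by (auto simp: G_def)
    have "norm w = c * norm (x + (\<beta> / c) *\<^sub>R y)"
      using True norm_scaleR[of c "x + (\<beta> / c) *\<^sub>R y"] by (simp add: w scaleR_add_right)
    then show ?thesis using birkhoff True by simp
  next
    case False
    then show ?thesis using norm_ge_zero[of w] by linarith
  qed
  have zero: "(0, 0) \<in> G" by (force simp: G_def)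
  have add: "(v + w, c + d) \<in> G" if vw: "(v, c) \<in> G" "(w, d) \<in> G" for v w c d
  proof -
    obtain \<beta> \<gamma> where "v = c *\<^sub>R x + \<beta> *\<^sub>R y" "w = d *\<^sub>R x + \<gamma> *\<^sub>R y"
      using vw by (auto simp: G_def)
    then have "v + w = (c + d) *\<^sub>R x + (\<beta> + \<gamma>) *\<^sub>R y" by (simp add: algebra_simps)
    then show ?thesis unfolding G_def by blast
  qed
  have scale: "(s *\<^sub>R w, s * d) \<in> G" if wd: "(w, d) \<in> G" for s w d
  proof -
    obtain \<gamma> where "w = d *\<^sub>R x + \<gamma> *\<^sub>R y"
      using wd by (auto simp: G_def)
    then have "s *\<^sub>R w = (s * d) *\<^sub>R x + (s * \<gamma>) *\<^sub>R y" by (simp add: algebra_simps)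
    then show ?thesis unfolding G_def by blast
  qed
  obtain q where q: "sublinear q" "\<And>z. q z \<le> norm z" "\<And>w c. (w, c) \<in> G \<Longrightarrow> q (- w) \<le> - c"
    using sublinear_below_on_cone[OF sub zero add scale le] by blast
  obtain p where p: "linear p" "\<And>z. p z \<le> q z"
    using hahn_banach_sublinear[OF q(1)] by metis
  have p_le: "p z \<le> norm z" for z
    using p(2)[of z] q(2)[of z] by linarith
  have p_ge: "c \<le> p w" if "(w, c) \<in> G" for w c
    using q(3)[OF that] p(2)[of "- w"] linear_neg[OF p(1), of w] by linarith
  have "(x, 1) \<in> G"
    by (force simp: G_def intro: exI[of _ 1] exI[of _ 0])
  moreover have "(y, 0) \<in> G" "(- y, 0) \<in> G"
    by (force simp: G_def intro: exI[of _ 0] exI[of _ 1] exI[of _ "- 1"])+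
  ultimately have px: "p x = 1" and py: "p y = 0"
    using p_ge[of x 1] p_ge[of y 0] p_ge[of "- y" 0] p_le[of x] assms linear_neg[OF p(1), of y]
    by auto
  have "bounded_linear p"
  proof (rule bounded_linear_intro[of p 1])
    show "norm (p z) \<le> norm z * 1" for z
      using p_le[of z] p_le[of "- z"] linear_neg[OF p(1), of z] by auto
  qed (use p(1) in \<open>auto simp: linear_add linear_scale\<close>)
  then have apply_p: "blinfun_apply (Blinfun p) = p"
    by (rule bounded_linear_Blinfun_apply)
  have "norm (Blinfun p) = 1"
  proof (rule antisym)
    show "norm (Blinfun p) \<le> 1"
      using p_le linear_neg[OF p(1)]
      by (intro norm_blinfun_bound) (auto simp: apply_p abs_le_iff, metis norm_minus_cancel)
    show "1 \<le> norm (Blinfun p)"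
      using norm_blinfun[of "Blinfun p" x] by (simp add: apply_p px assms)
  qed
  then show "quasiorthogonal y x"
    unfolding quasiorthogonal_def using px py assms apply_p by force
qed

text \<open>The pairs \<open>y \<urcorner> x\<close> of unit vectors over which both moduli range, in metric form.\<close>

definition birkhoff_pair :: "'a::real_normed_vector \<Rightarrow> 'a \<Rightarrow> bool" where
  "birkhoff_pair x y \<longleftrightarrow> norm x = 1 \<and> norm y = 1 \<and> (\<forall>t. 1 \<le> norm (x + t *\<^sub>R y))"

lemma birkhoff_pair_iff_quasiorthogonal:
  "x \<in> sphere 0 1 \<and> y \<in> sphere 0 1 \<and> quasiorthogonal y x \<longleftrightarrow> birkhoff_pair x y"
  by (auto simp: birkhoff_pair_def quasiorthogonal_iff_birkhoff)

lemma birkhoff_pair_norm: "birkhoff_pair x y \<Longrightarrow> norm x = 1" "birkhoff_pair x y \<Longrightarrow> norm y = 1"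
  by (auto simp: birkhoff_pair_def)

lemma birkhoff_pair_norm_ge:
  assumes "birkhoff_pair x y"
  shows "\<bar>c\<bar> \<le> norm (c *\<^sub>R x + d *\<^sub>R y)"
proof (cases "c = 0")
  case False
  then have "c *\<^sub>R x + d *\<^sub>R y = c *\<^sub>R (x + (d / c) *\<^sub>R y)"
    by (simp add: scaleR_add_right)
  then have "norm (c *\<^sub>R x + d *\<^sub>R y) = \<bar>c\<bar> * norm (x + (d / c) *\<^sub>R y)"
    by (metis norm_scaleR)
  then show ?thesis
    using assms by (simp add: birkhoff_pair_def mult_le_cancel_left1)
qed simp

lemma birkhoff_pair_independent:
  assumes "birkhoff_pair x y" "c *\<^sub>R x + d *\<^sub>R y = 0"
  shows "c = 0" "d = 0"
proof -
  show "c = 0" using birkhoff_pair_norm_ge[OF assms(1), of c d] assms(2) by simp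
  then show "d = 0" using assms birkhoff_pair_norm(2)[OF assms(1)] by auto
qed

lemma birkhoff_pair_uminus_left: "birkhoff_pair x y \<Longrightarrow> birkhoff_pair (- x) y"
  and birkhoff_pair_uminus_right: "birkhoff_pair x y \<Longrightarrow> birkhoff_pair x (- y)"
proof -
  assume xy: "birkhoff_pair x y"
  have ge: "1 \<le> norm (x + (- t) *\<^sub>R y)" for t using xy unfolding birkhoff_pair_def by blast
  have "norm (- x + t *\<^sub>R y) = norm (x + (- t) *\<^sub>R y)" for t
    by (metis minus_add_distrib minus_minus norm_minus_cancel scaleR_minus_left)
  then have "1 \<le> norm (- x + t *\<^sub>R y)" for t using ge[of t] by (simp only:)
  then show "birkhoff_pair (- x) y" using xy by (simp only: birkhoff_pair_def norm_minus_cancel) blast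
  from ge show "birkhoff_pair x (- y)" using xy by (simp add: birkhoff_pair_def)
qed

text \<open>The point of the line \<open>e + \<real> w\<close> nearest to the origin is orthogonal to \<open>w\<close> in the sense of Birkhoff.\<close>

lemma exists_birkhoff_pair_over:
  fixes e w :: "'a::real_normed_vector"
  assumes w: "norm w = 1" and e: "\<And>t. e \<noteq> t *\<^sub>R w"
  obtains t m where "m > 0" "birkhoff_pair ((1 / m) *\<^sub>R (e + t *\<^sub>R w)) w"
proof -
  define f where "f t = norm (e + t *\<^sub>R w)" for t
  define R where "R = 2 * norm e"
  have "\<exists>t0\<in>{- R..R}. \<forall>t\<in>{- R..R}. f t0 \<le> f t"
    unfolding f_def R_def by (intro continuous_attains_inf continuous_intros) auto
  then obtain t0 where t0: "\<And>t. t \<in> {- R..R} \<Longrightarrow> f t0 \<le> f t" by blast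
  have min: "f t0 \<le> f t" for t
  proof (cases "t \<in> {- R..R}")
    case False
    have "\<bar>t\<bar> - norm e \<le> f t"
      using norm_triangle_ineq2[of "t *\<^sub>R w" "- e"] w by (simp add: f_def add.commute)
    moreover have "R < \<bar>t\<bar>" using False by auto
    moreover have "f t0 \<le> norm e" using t0[of 0] by (simp add: f_def R_def)
    ultimately show ?thesis by (simp add: R_def)
  qed (rule t0)
  have pos: "0 < f t0"
  proof -
    have "e + t0 *\<^sub>R w \<noteq> 0" using e[of "- t0"] by (simp add: add_eq_0_iff2)
    then show ?thesis by (simp add: f_def)
  qed
  have "birkhoff_pair ((1 / f t0) *\<^sub>R (e + t0 *\<^sub>R w)) w"
    unfolding birkhoff_pair_def
  proof (intro conjI allI)
    show "norm ((1 / f t0) *\<^sub>R (e + t0 *\<^sub>R w)) = 1"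
      using pos by (simp add: f_def)
    fix s
    have "(1 / f t0) *\<^sub>R (e + t0 *\<^sub>R w) + s *\<^sub>R w = (1 / f t0) *\<^sub>R (e + (t0 + s * f t0) *\<^sub>R w)"
      using pos by (simp add: algebra_simps)
    then have "norm ((1 / f t0) *\<^sub>R (e + t0 *\<^sub>R w) + s *\<^sub>R w) = f (t0 + s * f t0) / f t0"
      using pos by (simp add: f_def)
    then show "1 \<le> norm ((1 / f t0) *\<^sub>R (e + t0 *\<^sub>R w) + s *\<^sub>R w)"
      using min[of "t0 + s * f t0"] pos by simp
  qed (rule w)
  then show ?thesis using that pos by blast
qed

section \<open>Minimal solutions on the unit sphere\<close>

lemma norm_le_on_segment:
  fixes x v :: "'a::real_normed_vector"
  assumes "0 \<le> s" "s \<le> t" "norm x \<le> c" "norm (x + t *\<^sub>R v) \<le> c"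
  shows "norm (x + s *\<^sub>R v) \<le> c"
proof (cases "t = 0")
  case False
  then have "(1 - s / t) *\<^sub>R x + (s / t) *\<^sub>R (x + t *\<^sub>R v) \<in> cball 0 c"
    using assms by (intro convexD_alt convex_cball) (auto simp: divide_simps)
  moreover have "(1 - s / t) *\<^sub>R x + (s / t) *\<^sub>R (x + t *\<^sub>R v) = x + s *\<^sub>R v"
    using False by (simp add: algebra_simps)
  ultimately show ?thesis by simp
qed (use assms in auto)

text \<open>The minimum exists because the norm is at least \<open>1 - l\<close> (Birkhoff orthogonality), so that no \<open>l < 0\<close> qualifies. By
  the intermediate value theorem, every \<open>l\<close> with norm at most \<open>1\<close> has a solution at or below it.\<close>

lemma supp_lambda_birkhoff_pair:
  assumes xy: "birkhoff_pair x y" and r: "0 \<le> r" "r \<le> 1"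
  shows norm_supp_lambda: "norm ((1 - supp_lambda x y r) *\<^sub>R x + r *\<^sub>R y) = 1" (is ?attained)
    and supp_lambda_nonneg: "0 \<le> supp_lambda x y r" (is ?nonneg)
    and supp_lambda_le: "\<And>l. norm ((1 - l) *\<^sub>R x + r *\<^sub>R y) \<le> 1 \<Longrightarrow> supp_lambda x y r \<le> l"
proof -
  define g where "g l = norm ((1 - l) *\<^sub>R x + r *\<^sub>R y)" for l
  define S where "S = {l. g l = 1}"
  have "x + r *\<^sub>R y - l *\<^sub>R x = (1 - l) *\<^sub>R x + r *\<^sub>R y" for l by (simp add: algebra_simps)
  then have least: "supp_lambda x y r = (LEAST l. l \<in> S)"
    by (simp only: supp_lambda_def S_def g_def mem_Collect_eq)
  have cont: "continuous_on A g" for A unfolding g_def by (intro continuous_intros)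
  have ge: "1 - l \<le> g l" for l
    using birkhoff_pair_norm_ge[OF xy, of "1 - l" r] by (simp add: g_def)
  have crossing: "\<exists>l'\<in>S. l' \<le> l" if "g l \<le> 1" for l
  proof -
    have "0 \<le> l" using ge[of l] that by simp
    then have "\<exists>l'. 0 \<le> l' \<and> l' \<le> l \<and> g l' = 1"
      using ge[of 0] that cont by (intro IVT2') auto
    then show ?thesis by (auto simp: S_def)
  qed
  have "g 1 \<le> 1" using birkhoff_pair_norm[OF xy] r by (simp add: g_def)
  then have "S \<noteq> {}" using crossing by blast
  moreover have nonneg: "0 \<le> l" if "l \<in> S" for l using ge[of l] that by (simp add: S_def)
  moreover have "closed S" unfolding S_def by (intro closed_Collect_eq cont continuous_intros)
  ultimately have "Inf S \<in> S" by (intro closed_contains_Inf bdd_belowI)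
  moreover have "Inf S \<le> l" if "l \<in> S" for l
    using that nonneg by (intro cInf_lower bdd_belowI)
  ultimately have eq: "supp_lambda x y r = Inf S"
    unfolding least by (intro Least_equality)
  show ?attained using \<open>Inf S \<in> S\<close> by (simp add: eq S_def g_def)
  show ?nonneg using nonneg \<open>Inf S \<in> S\<close> by (simp add: eq)
  show "supp_lambda x y r \<le> l" if l: "norm ((1 - l) *\<^sub>R x + r *\<^sub>R y) \<le> 1" for l
  proof -
    obtain l' where "l' \<in> S" "l' \<le> l" using crossing[of l] l by (auto simp: g_def)
    then show ?thesis using \<open>\<And>l. l \<in> S \<Longrightarrow> Inf S \<le> l\<close>[of l'] eq by simp
  qed
qed

lemma supp_lambda_le_one:
  assumes xy: "birkhoff_pair x y" and r: "0 \<le> r" "r \<le> 1"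
  shows "supp_lambda x y r \<le> 1"
  using r birkhoff_pair_norm[OF xy] by (intro supp_lambda_le[OF xy r]) simp

lemma norm_le_one_if_supp_lambda_le:
  assumes xy: "birkhoff_pair x y" and r: "0 \<le> r" "r \<le> 1"
    and m: "0 \<le> m" "supp_lambda x y r \<le> 1 - m"
  shows "norm (m *\<^sub>R x + r *\<^sub>R y) \<le> 1"
  using norm_le_on_segment[of m "1 - supp_lambda x y r" "r *\<^sub>R y" 1 x] m
    norm_supp_lambda[OF xy r] birkhoff_pair_norm[OF xy] r by (simp add: add.commute)

text \<open>On the ray \<open>m \<mapsto> m x + r y\<close> the norm is convex and starts below \<open>1\<close> because \<open>r < 1\<close>; once it has reached \<open>1\<close> it
  exceeds \<open>1\<close> strictly. For \<open>r = 1\<close> this fails when the unit sphere contains a segment in the direction \<open>x\<close>.\<close>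

lemma supp_lambda_ge:
  assumes xy: "birkhoff_pair x y" and r: "0 \<le> r" "r < 1"
    and m: "0 \<le> m" "1 \<le> norm (m *\<^sub>R x + r *\<^sub>R y)"
  shows "1 - m \<le> supp_lambda x y r"
proof (rule ccontr)
  assume less: "\<not> ?thesis"
  define M where "M = 1 - supp_lambda x y r"
  have M: "0 \<le> m" "m < M" "norm (M *\<^sub>R x + r *\<^sub>R y) = 1"
    using less m norm_supp_lambda[OF xy] r by (auto simp: M_def)
  define \<theta> where "\<theta> = m / M"
  have \<theta>: "0 \<le> \<theta>" "\<theta> < 1" "\<theta> * M = m" using M by (auto simp: \<theta>_def)
  have "m *\<^sub>R x + r *\<^sub>R y = \<theta> *\<^sub>R (M *\<^sub>R x + r *\<^sub>R y) + (1 - \<theta>) *\<^sub>R (r *\<^sub>R y)"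
    using \<theta>(3) by (simp add: algebra_simps)
  then have "norm (m *\<^sub>R x + r *\<^sub>R y)
      \<le> norm (\<theta> *\<^sub>R (M *\<^sub>R x + r *\<^sub>R y)) + norm ((1 - \<theta>) *\<^sub>R (r *\<^sub>R y))"
    using norm_triangle_ineq by metis
  also have "\<dots> = \<theta> + (1 - \<theta>) * r"
    unfolding norm_scaleR M(3) birkhoff_pair_norm(2)[OF xy] using \<theta> r by simp
  also have "\<dots> < \<theta> + (1 - \<theta>) * 1"
    using \<theta> r by (intro add_strict_left_mono mult_strict_left_mono) auto
  finally show False using m by simp
qed

section \<open>Area of a tangent sweep in the plane\<close>

text \<open>The determinant of the plane \<open>\<real>\<^sup>2\<close>, which is modelled by the complex numbers.\<close>

definition area_form :: "complex \<Rightarrow> complex \<Rightarrow> real" where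
  "area_form z w = Re z * Im w - Im z * Re w"

lemma bilinear_area_form: "bilinear area_form"
  unfolding bilinear_def area_form_def by (auto intro!: linearI simp: algebra_simps)

lemmas area_form_simps =
  bilinear_ladd[OF bilinear_area_form] bilinear_radd[OF bilinear_area_form]
  bilinear_lmul[OF bilinear_area_form] bilinear_rmul[OF bilinear_area_form]
  bilinear_lsub[OF bilinear_area_form] bilinear_rsub[OF bilinear_area_form]
  bilinear_lneg[OF bilinear_area_form] bilinear_rneg[OF bilinear_area_form]
  bilinear_lzero[OF bilinear_area_form] bilinear_rzero[OF bilinear_area_form]

lemma area_form_self [simp]: "area_form z z = 0"
  and area_form_rotate: "area_form (- \<i> * z) z = (norm z)\<^sup>2"
  by (simp_all add: area_form_def cmod_power2) (simp add: power2_eq_square)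

lemma continuous_on_area_form [continuous_intros]:
  "continuous_on A f \<Longrightarrow> continuous_on A g \<Longrightarrow> continuous_on A (\<lambda>x. area_form (f x) (g x))"
  unfolding area_form_def by (intro continuous_intros)

lemma negligible_area_form_line:
  assumes "d \<noteq> 0"
  shows "negligible {z. area_form d (z - c) = 0}"
proof -
  have "{z. area_form d (z - c) = 0} = {z. (\<i> * d) \<bullet> z = area_form d c}"
    by (auto simp: area_form_def inner_complex_def algebra_simps)
  then show ?thesis using assms by (simp add: negligible_hyperplane)
qed

text \<open>The directions \<open>u\<close> for which all of \<open>V\<close> lies on one fixed side of the oriented line through \<open>a\<close> with direction
  \<open>u\<close>. This is the normal cone of the convex hull of \<open>V\<close> at \<open>a\<close>, turned by a right angle.\<close>

definition normal_cone :: "complex set \<Rightarrow> complex \<Rightarrow> complex set" where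
  "normal_cone V a = {u. \<forall>b\<in>V. area_form b u \<le> area_form a u}"

lemma closed_normal_cone: "closed (normal_cone V a)"
proof -
  have "normal_cone V a = (\<Inter>b\<in>V. {u. area_form b u \<le> area_form a u})"
    by (auto simp: normal_cone_def)
  then show ?thesis
    by (auto intro!: closed_INT closed_Collect_le continuous_intros)
qed

lemma normal_cone_scaleR: "u \<in> normal_cone V a \<Longrightarrow> 0 \<le> s \<Longrightarrow> s *\<^sub>R u \<in> normal_cone V a"
  by (auto simp: normal_cone_def area_form_simps intro: mult_left_mono)

text \<open>The tangent sweep of the polygon with vertices \<open>\<mu> a\<close>, \<open>a \<in> V\<close>: along an edge the swept segments only cover
  a null set, and at the vertex \<open>\<mu> a\<close> they cover a translated sector of \<open>D\<close>.\<close>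

definition moved_sectors :: "complex set \<Rightarrow> real \<Rightarrow> complex set \<Rightarrow> complex set" where
  "moved_sectors V \<mu> D = (\<Union>a\<in>V. (+) (\<mu> *\<^sub>R a) ` (D \<inter> normal_cone V a))"

text \<open>Two translated sectors overlap at most in a line: a common point \<open>\<mu> a + u = \<mu> b + v\<close> makes \<open>v - u\<close>
  parallel to \<open>a - b\<close>, while the two cone conditions put \<open>u\<close> and \<open>v\<close> on opposite sides of the direction of
  \<open>a - b\<close>. This holds for every \<open>\<mu>\<close>, so the area is the same as for \<open>\<mu> = 0\<close>, where the sectors fill \<open>D\<close>.\<close>

lemma measure_moved_sectors:
  assumes V: "finite V" "V \<noteq> {}" and D: "compact D"
  shows "moved_sectors V \<mu> D \<in> lmeasurable"
    and "measure lebesgue (moved_sectors V \<mu> D) = measure lebesgue D"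
proof -
  have meas: "D \<inter> normal_cone V a \<in> lmeasurable" for a
    using D closed_normal_cone by (intro lmeasurable_compact compact_Int_closed)
  have negl: "negligible ((+) (\<mu> *\<^sub>R a) ` (D \<inter> normal_cone V a) \<inter> (+) (\<mu> *\<^sub>R b) ` (D \<inter> normal_cone V b))"
    if ab: "a \<in> V" "b \<in> V" "a \<noteq> b" for a b \<mu>
  proof (rule negligible_subset)
    show "negligible {z. area_form (a - b) (z - \<mu> *\<^sub>R a) = 0}"
      using ab by (intro negligible_area_form_line) auto
    show "(+) (\<mu> *\<^sub>R a) ` (D \<inter> normal_cone V a) \<inter> (+) (\<mu> *\<^sub>R b) ` (D \<inter> normal_cone V b)
        \<subseteq> {z. area_form (a - b) (z - \<mu> *\<^sub>R a) = 0}"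
    proof
      fix z assume "z \<in> (+) (\<mu> *\<^sub>R a) ` (D \<inter> normal_cone V a) \<inter> (+) (\<mu> *\<^sub>R b) ` (D \<inter> normal_cone V b)"
      then obtain u v where uv: "u \<in> normal_cone V a" "v \<in> normal_cone V b"
        "z = \<mu> *\<^sub>R a + u" "z = \<mu> *\<^sub>R b + v"
        by auto
      have "0 \<le> area_form (a - b) u" "area_form (a - b) v \<le> 0"
        using uv ab by (auto simp: normal_cone_def area_form_simps)
      moreover have "v = u + \<mu> *\<^sub>R (a - b)"
        using uv(3,4) by (simp add: algebra_simps)
      then have "area_form (a - b) v = area_form (a - b) u"
        by (simp add: area_form_simps(2,4))
      ultimately show "z \<in> {z. area_form (a - b) (z - \<mu> *\<^sub>R a) = 0}"
        using uv(3) by simp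
    qed
  qed
  have sum: "measure lebesgue (moved_sectors V \<mu> D) = (\<Sum>a\<in>V. measure lebesgue (D \<inter> normal_cone V a))" for \<mu>
  proof -
    have "measure lebesgue (moved_sectors V \<mu> D)
        = (\<Sum>a\<in>V. measure lebesgue ((+) (\<mu> *\<^sub>R a) ` (D \<inter> normal_cone V a)))"
      unfolding moved_sectors_def using V meas negl
      by (intro measure_negligible_finite_Union_image) (auto simp: pairwise_def intro: measurable_translation)
    then show ?thesis by (simp only: measure_translation)
  qed
  \<comment> \<open>every direction lies in the cone of the vertex that maximises \<open>area_form _ u\<close>\<close>
  have "moved_sectors V 0 D = D"
  proof -
    have "\<exists>a\<in>V. u \<in> normal_cone V a" for u
    proof -
      have "Max ((\<lambda>a. area_form a u) ` V) \<in> (\<lambda>a. area_form a u) ` V"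
        using V by (intro Max_in) auto
      then obtain a where "a \<in> V" "area_form a u = Max ((\<lambda>a. area_form a u) ` V)" by auto
      then show ?thesis
        using V Max_ge[of "(\<lambda>a. area_form a u) ` V"] by (intro bexI[of _ a]) (auto simp: normal_cone_def)
    qed
    then show ?thesis by (auto simp: moved_sectors_def)
  qed
  then show "measure lebesgue (moved_sectors V \<mu> D) = measure lebesgue D"
    using sum[of 0] sum[of \<mu>] by simp
  show "moved_sectors V \<mu> D \<in> lmeasurable"
    unfolding moved_sectors_def using V meas by (intro fmeasurable.finite_UN measurable_translation) auto
qed

text \<open>Seen from a point \<open>z\<close> outside \<open>C\<close>, all the points \<open>\<mu> b\<close> lie in an open half plane, so they are
  linearly ordered by their slope; the extreme one is the tangent vertex. Hence the tangent sweep with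
  unbounded segments covers the complement of \<open>C\<close>.\<close>

lemma exists_tangent_vertex:
  fixes C :: "complex set"
  assumes V: "finite V" "V \<noteq> {}" "\<And>b. b \<in> V \<Longrightarrow> \<mu> *\<^sub>R b \<in> C"
    and C: "closed C" "convex C" "z \<notin> C" and \<mu>: "0 < \<mu>"
  shows "\<exists>a\<in>V. z - \<mu> *\<^sub>R a \<in> normal_cone V a"
proof -
  obtain e \<beta> where sep: "e \<bullet> z < \<beta>" "\<And>x. x \<in> C \<Longrightarrow> \<beta> < e \<bullet> x"
    using separating_hyperplane_closed_point[OF C(2,1,3)] by auto
  \<comment> \<open>\<open>c b\<close> is the vertex seen from \<open>z\<close>, and \<open>t b\<close> its slope relative to the separating direction \<open>e\<close>\<close>
  define c where "c b = \<mu> *\<^sub>R b - z" for b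
  have pos: "0 < e \<bullet> c b" if "b \<in> V" for b
    using sep V(3)[OF that] by (force simp: c_def inner_diff_right)
  have "e \<noteq> 0"
    using pos V(2) by force
  then have e: "0 < (norm e)\<^sup>2" by simp
  define t where "t b = area_form e (c b) / (e \<bullet> c b)" for b
  have "Max (t ` V) \<in> t ` V" using V by (intro Max_in) auto
  then obtain a where "a \<in> V" "Max (t ` V) = t a" by blast
  then have a: "a \<in> V" "\<And>b. b \<in> V \<Longrightarrow> t b \<le> t a"
    using V(1) Max_ge[of "t ` V"] by auto
  have "area_form b (z - \<mu> *\<^sub>R a) \<le> area_form a (z - \<mu> *\<^sub>R a)" if b: "b \<in> V" for b
  proof -
    have "(norm e)\<^sup>2 * area_form (c b) (c a) = (e \<bullet> c b) * area_form e (c a) - area_form e (c b) * (e \<bullet> c a)"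
      unfolding cmod_power2 by (simp add: area_form_def inner_complex_def power2_eq_square algebra_simps)
    also have "\<dots> = (e \<bullet> c b) * (e \<bullet> c a) * (t a - t b)"
      using pos[OF a(1)] pos[OF b] by (simp add: t_def field_simps)
    also have "\<dots> \<ge> 0"
      using pos[OF a(1)] pos[OF b] a(2)[OF b] by simp
    finally have "0 \<le> area_form (c b) (c a)" using e by (simp add: zero_le_mult_iff)
    moreover have "area_form (c b) (c a) = area_form (c b - c a) (c a)"
      by (simp add: area_form_simps)
    moreover have "c b - c a = \<mu> *\<^sub>R (b - a)" by (simp add: c_def algebra_simps)
    ultimately have "0 \<le> \<mu> * area_form (b - a) (c a)" by (simp add: area_form_simps(3))
    then have "0 \<le> area_form (b - a) (c a)" using \<mu> by (simp add: zero_le_mult_iff)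
    moreover have "z - \<mu> *\<^sub>R a = - c a" by (simp add: c_def)
    ultimately show ?thesis by (simp add: area_form_simps)
  qed
  then show ?thesis using a(1) by (auto simp: normal_cone_def)
qed

section \<open>Tangent pairs in a normed plane\<close>

text \<open>A plane in a normed space, parametrised by the complex numbers in order to have Lebesgue measure at hand.\<close>

locale normed_plane =
  fixes T :: "complex \<Rightarrow> 'a::real_normed_vector"
  assumes linear: "linear T" and inj: "inj T"
begin

lemmas T_simps = linear_add[OF linear] linear_diff[OF linear] linear_scale[OF linear]
  linear_neg[OF linear] linear_0[OF linear]

lemma T_eq_0_iff [simp]: "T z = 0 \<longleftrightarrow> z = 0"
  using inj linear by (metis injD linear_0)

lemma continuous_on_T [continuous_intros]: "continuous_on A f \<Longrightarrow> continuous_on A (\<lambda>x. T (f x))"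
  using linear linear_continuous_on linear_linear continuous_on_compose2
  by (metis subset_UNIV)

lemma norm_T_bounded_below: "\<exists>c>0. \<forall>z. c * norm z \<le> norm (T z)"
proof -
  have "sphere 0 1 \<noteq> ({} :: complex set)" by (metis norm_one mem_sphere_0 empty_iff)
  then have "\<exists>m\<in>sphere 0 1. \<forall>w\<in>sphere 0 1. norm (T m) \<le> norm (T w)"
    by (intro continuous_attains_inf continuous_intros) auto
  then obtain m where m: "norm m = 1" "\<And>w. norm w = 1 \<Longrightarrow> norm (T m) \<le> norm (T w)"
    by auto
  have "norm (T m) * norm z \<le> norm (T z)" for z
  proof (cases "z = 0")
    case False
    then have "norm (T m) \<le> norm (T ((1 / norm z) *\<^sub>R z))"
      by (intro m) simp
    then show ?thesis
      using False by (simp add: T_simps field_simps)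
  qed simp
  moreover have "0 < norm (T m)" using m by force
  ultimately show ?thesis by blast
qed

definition disc :: "real \<Rightarrow> complex set" where "disc \<rho> = {z. norm (T z) \<le> \<rho>}"

lemma compact_disc: "compact (disc \<rho>)"
  unfolding compact_eq_bounded_closed
proof
  obtain c where c: "c > 0" "\<And>z. c * norm z \<le> norm (T z)"
    using norm_T_bounded_below by blast
  have "norm z \<le> \<rho> / c" if "z \<in> disc \<rho>" for z
    using c(1) c(2)[of z] that by (simp add: disc_def field_simps)
  then show "bounded (disc \<rho>)" by (rule boundedI)
  show "closed (disc \<rho>)"
    unfolding disc_def by (intro closed_Collect_le continuous_intros)
qed

lemma convex_disc: "convex (disc \<rho>)"
proof (rule convexI)
  fix x y :: complex and u v :: real
  assume "x \<in> disc \<rho>" "y \<in> disc \<rho>" "0 \<le> u" "0 \<le> v" "u + v = 1"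
  then show "u *\<^sub>R x + v *\<^sub>R y \<in> disc \<rho>"
    using convexD[OF convex_cball, of "T x" 0 \<rho> "T y" u v] by (simp add: disc_def T_simps)
qed

lemma measure_disc:
  assumes "0 < \<rho>"
  shows "measure lebesgue (disc \<rho>) = \<rho>\<^sup>2 * measure lebesgue (disc 1)"
proof -
  have "disc \<rho> = (\<lambda>z. \<rho> *\<^sub>R z + 0) ` disc 1"
  proof
    show "disc \<rho> \<subseteq> (\<lambda>z. \<rho> *\<^sub>R z + 0) ` disc 1"
    proof
      fix z assume "z \<in> disc \<rho>"
      then show "z \<in> (\<lambda>z. \<rho> *\<^sub>R z + 0) ` disc 1"
        using assms by (intro image_eqI[of _ _ "(1 / \<rho>) *\<^sub>R z"]) (auto simp: disc_def T_simps)
    qed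
  qed (use assms in \<open>auto simp: disc_def T_simps\<close>)
  then show ?thesis
    using measure_lebesgue_affine[of \<rho> 0 "disc 1"] by simp
qed

lemma measure_disc_pos: "0 < measure lebesgue (disc 1)"
proof -
  have "open {z. norm (T z) < 1}"
    by (intro open_Collect_less continuous_intros)
  moreover have "0 \<in> {z. norm (T z) < 1}" by (simp add: T_simps)
  ultimately have "\<not> negligible {z. norm (T z) < 1}"
    using open_not_negligible by blast
  then have "\<not> negligible (disc 1)"
    by (rule contrapos_nn) (auto simp: disc_def intro: negligible_subset)
  then show ?thesis
    using negligible_iff_measure0[OF lmeasurable_compact[OF compact_disc]] by (simp add: zero_less_measure_iff)
qed

lemma finite_net_exists:
  assumes "0 < \<epsilon>"
  obtains V where "finite V" "V \<noteq> {}" "\<And>a. a \<in> V \<Longrightarrow> norm (T a) = 1"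
    "\<And>b. norm (T b) = 1 \<Longrightarrow> \<exists>a\<in>V. norm (T (b - a)) < \<epsilon>"
proof -
  define S where "S = {z. norm (T z) = 1}"
  have "closed S" unfolding S_def by (intro closed_Collect_eq continuous_intros)
  then have "compact (disc 1 \<inter> S)" by (intro compact_Int_closed compact_disc)
  moreover have "disc 1 \<inter> S = S" by (auto simp: S_def disc_def)
  ultimately have "compact S" by simp
  then have fin: "\<exists>V\<subseteq>S. finite V \<and> S \<subseteq> (\<Union>a\<in>V. {b. norm (T (b - a)) < \<epsilon>})"
  proof (rule compactE_image[of S S "\<lambda>a. {b. norm (T (b - a)) < \<epsilon>}"])
    show "open {b. norm (T (b - a)) < \<epsilon>}" for a
      by (intro open_Collect_less continuous_intros)
    show "S \<subseteq> (\<Union>a\<in>S. {b. norm (T (b - a)) < \<epsilon>})"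
      using assms by (force simp: T_simps)
  qed blast
  then obtain V where V: "V \<subseteq> S" "finite V" "S \<subseteq> (\<Union>a\<in>V. {b. norm (T (b - a)) < \<epsilon>})" by blast
  have "(1 / norm (T 1)) *\<^sub>R 1 \<in> S" by (simp add: S_def T_simps)
  then have "V \<noteq> {}" using V(3) by auto
  then show ?thesis using that[of V] V by (auto simp: S_def)
qed

text \<open>Up to the factor \<open>1 - \<epsilon>\<close>, the line through \<open>a\<close> with direction \<open>u\<close> supports the unit disc; for \<open>\<epsilon> = 0\<close> it
  does so exactly.\<close>

definition almost_normal :: "real \<Rightarrow> complex \<Rightarrow> complex \<Rightarrow> bool" where
  "almost_normal \<epsilon> a u \<longleftrightarrow> (\<forall>b\<in>disc 1. (1 - \<epsilon>) * area_form b u \<le> area_form a u)"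

lemma area_form_support:
  assumes "u \<noteq> 0"
  obtains b where "norm (T b) = 1" "0 < area_form b u" "\<And>c. c \<in> disc 1 \<Longrightarrow> area_form c u \<le> area_form b u"
proof -
  have "0 \<in> disc 1" by (simp add: disc_def T_simps)
  then have "\<exists>b\<in>disc 1. \<forall>c\<in>disc 1. area_form c u \<le> area_form b u"
    by (intro continuous_attains_sup continuous_intros compact_disc) auto
  then obtain b where b: "b \<in> disc 1" "\<And>c. c \<in> disc 1 \<Longrightarrow> area_form c u \<le> area_form b u"
    by blast
  \<comment> \<open>a vector on which \<open>area_form _ u\<close> is positive, so that the maximum is positive\<close>
  define w where "w = - \<i> * u"
  define s where "s = norm (T w)"
  have "0 < s" using assms by (simp add: s_def w_def)
  then have "(1 / s) *\<^sub>R w \<in> disc 1" by (simp add: disc_def T_simps s_def[symmetric])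
  then have "area_form ((1 / s) *\<^sub>R w) u \<le> area_form b u" by (rule b(2))
  moreover have "0 < area_form ((1 / s) *\<^sub>R w) u"
    using \<open>0 < s\<close> assms unfolding area_form_simps(3) w_def area_form_rotate by simp
  ultimately have pos: "0 < area_form b u" by simp
  then have "b \<noteq> 0" by (auto simp: area_form_simps)
  then have nb: "0 < norm (T b)" "norm (T b) \<le> 1" using b(1) by (auto simp: disc_def)
  then have "(1 / norm (T b)) *\<^sub>R b \<in> disc 1" by (simp add: disc_def T_simps)
  then have "area_form ((1 / norm (T b)) *\<^sub>R b) u \<le> area_form b u" by (rule b(2))
  then have "1 \<le> norm (T b)" using nb(1) pos by (simp add: area_form_simps(3) field_simps)
  then show ?thesis using that[of b] b pos nb by auto
qed

text \<open>The support point of the disc in direction \<open>u\<close> has a net point closer than \<open>\<epsilon>\<close>, so passing from the disc to the net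
  lowers the support value by less than the factor \<open>1 - \<epsilon>\<close>. The inequality is strict because the net distances are;
  \<open>exists_almost_normal_norm_ge\<close> needs this for disjointness.\<close>

lemma normal_cone_net:
  assumes V: "\<And>b. norm (T b) = 1 \<Longrightarrow> \<exists>a\<in>V. norm (T (b - a)) < \<epsilon>"
    and u: "u \<noteq> 0" "u \<in> normal_cone V a" and c: "norm (T c) \<le> 1 - \<epsilon>"
  shows "area_form c u < area_form a u"
proof -
  obtain b where b: "norm (T b) = 1" "0 < area_form b u"
    "\<And>c. c \<in> disc 1 \<Longrightarrow> area_form c u \<le> area_form b u"
    using area_form_support[OF u(1)] by metis
  have scaled: "area_form c u \<le> norm (T c) * area_form b u" for c
  proof (cases "c = 0")
    case False
    have "(1 / norm (T c)) *\<^sub>R c \<in> disc 1" by (simp add: disc_def T_simps)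
    from b(3)[OF this] show ?thesis using False by (simp add: area_form_simps(3) field_simps)
  qed (simp add: area_form_simps T_simps)
  obtain a' where a': "a' \<in> V" "norm (T (b - a')) < \<epsilon>" using V b(1) by blast
  have "area_form c u \<le> (1 - \<epsilon>) * area_form b u"
    using scaled[of c] mult_right_mono[OF c, of "area_form b u"] b(2) by linarith
  also have "\<dots> < area_form b u - norm (T (b - a')) * area_form b u"
    using mult_strict_right_mono[OF a'(2) b(2)] by (simp add: algebra_simps)
  also have "\<dots> \<le> area_form b u - area_form (b - a') u"
    using scaled[of "b - a'"] by simp
  also have "\<dots> = area_form a' u" by (simp add: area_form_simps)
  also have "\<dots> \<le> area_form a u" using u(2) a'(1) by (auto simp: normal_cone_def)
  finally show ?thesis .
qed

lemma almost_normal_net: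
  assumes V: "\<And>b. norm (T b) = 1 \<Longrightarrow> \<exists>a\<in>V. norm (T (b - a)) < \<epsilon>"
    and u: "u \<noteq> 0" "u \<in> normal_cone V a" and \<epsilon>: "\<epsilon> \<le> 1"
  shows "almost_normal \<epsilon> a u"
  unfolding almost_normal_def
proof
  fix b assume b: "b \<in> disc 1"
  have "norm (T ((1 - \<epsilon>) *\<^sub>R b)) \<le> 1 - \<epsilon>"
    using b \<epsilon> mult_left_mono[of "norm (T b)" 1 "1 - \<epsilon>"] by (simp add: disc_def T_simps)
  then have "area_form ((1 - \<epsilon>) *\<^sub>R b) u < area_form a u"
    using normal_cone_net[OF V u] by blast
  then show "(1 - \<epsilon>) * area_form b u \<le> area_form a u" by (simp add: area_form_simps(3))
qed

text \<open>Otherwise the disc of radius \<open>\<mu>\<close> and the moved sectors, of total area at most \<open>(\<mu>\<^sup>2 + r\<^sup>2) |K| = |K|\<close>, would cover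
  the disc of radius \<open>1 + \<delta>\<close>.\<close>

lemma exists_almost_normal_norm_le:
  assumes r: "0 < r" "0 < \<mu>" "\<mu>\<^sup>2 + r\<^sup>2 = 1" and \<delta>: "0 < \<delta>" "\<delta> < 1"
  shows "\<exists>a u. norm (T a) = 1 \<and> norm (T u) = 1 \<and> almost_normal \<delta> a u \<and>
    norm (T (\<mu> *\<^sub>R a + r *\<^sub>R u)) \<le> 1 + \<delta>"
proof (rule ccontr)
  assume none: "\<not> ?thesis"
  obtain V where V: "finite V" "V \<noteq> {}" "\<And>a. a \<in> V \<Longrightarrow> norm (T a) = 1"
    "\<And>b. norm (T b) = 1 \<Longrightarrow> \<exists>a\<in>V. norm (T (b - a)) < \<delta>"
    using finite_net_exists[OF \<delta>(1)] by metis
  have far: "1 + \<delta> < norm (T (\<mu> *\<^sub>R a + r *\<^sub>R u))"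
    if "a \<in> V" "u \<in> normal_cone V a" "norm (T u) = 1" for a u
  proof -
    have "u \<noteq> 0" using that(3) by (auto simp: T_simps)
    then have "almost_normal \<delta> a u" using almost_normal_net[OF V(4)] that \<delta> by simp
    then show ?thesis using none V(3) that by (meson not_le less_imp_le)
  qed
  define F where "F = moved_sectors V \<mu> (disc r)"
  have pos: "0 < 1 + \<delta>" using \<delta> by simp
  have "\<mu> < 1" using r by (smt (verit) one_le_power zero_less_power)
  have "disc (1 + \<delta>) \<subseteq> disc \<mu> \<union> F"
  proof
    fix z assume z: "z \<in> disc (1 + \<delta>)"
    show "z \<in> disc \<mu> \<union> F"
    proof (cases "z \<in> disc \<mu>")
      case False
      then obtain a where a: "a \<in> V" "z - \<mu> *\<^sub>R a \<in> normal_cone V a"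
        using exists_tangent_vertex[OF V(1,2) _ compact_imp_closed[OF compact_disc] convex_disc, of \<mu> \<mu>]
          V(3) r(2) by (auto simp: disc_def T_simps)
      define w where "w = z - \<mu> *\<^sub>R a"
      have "norm (T w) \<le> r"
      proof (rule ccontr)
        assume "\<not> norm (T w) \<le> r"
        define s where "s = norm (T w)"
        define u where "u = (1 / s) *\<^sub>R w"
        have s: "r < s" using \<open>\<not> norm (T w) \<le> r\<close> by (simp add: s_def)
        have u: "u \<in> normal_cone V a" "norm (T u) = 1"
          using a(2) s r(1) by (auto simp: u_def w_def[symmetric] s_def T_simps intro!: normal_cone_scaleR)
        have "z = \<mu> *\<^sub>R a + s *\<^sub>R u" using s r(1) by (simp add: u_def w_def)
        then have "norm (T (\<mu> *\<^sub>R a) + r *\<^sub>R T u) \<le> 1 + \<delta>"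
          using z V(3)[OF a(1)] \<open>\<mu> < 1\<close> r s \<delta>
          by (intro norm_le_on_segment[of r s]) (auto simp: disc_def T_simps)
        then show False using far[OF a(1) u] by (simp add: T_simps)
      qed
      then have "w \<in> disc r \<inter> normal_cone V a" using a by (simp add: disc_def w_def)
      moreover have "z = \<mu> *\<^sub>R a + w" by (simp add: w_def)
      ultimately show ?thesis unfolding F_def moved_sectors_def using a(1) by blast
    qed simp
  qed
  moreover have F: "F \<in> lmeasurable" "measure lebesgue F = measure lebesgue (disc r)"
    unfolding F_def by (intro measure_moved_sectors V compact_disc)+
  ultimately have "measure lebesgue (disc (1 + \<delta>)) \<le> measure lebesgue (disc \<mu> \<union> F)"
    using lmeasurable_compact[OF compact_disc]
    by (intro measure_mono_fmeasurable) (auto simp: fmeasurableD)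
  also have "\<dots> \<le> measure lebesgue (disc \<mu>) + measure lebesgue F"
    using lmeasurable_compact[OF compact_disc] F by (intro measure_Un_le) (auto simp: fmeasurableD)
  finally have "(1 + \<delta>)\<^sup>2 * measure lebesgue (disc 1) \<le> (\<mu>\<^sup>2 + r\<^sup>2) * measure lebesgue (disc 1)"
    unfolding F(2) measure_disc[OF pos] measure_disc[OF r(1)] measure_disc[OF r(2)] distrib_right .
  then have "(1 + \<delta>)\<^sup>2 \<le> 1"
    unfolding r(3) using measure_disc_pos mult_le_cancel_right_pos by blast
  then show False using \<delta> by (simp add: abs_square_le_1)
qed

text \<open>Otherwise the moved sectors and a slightly shrunken disc, which are disjoint, would both fit
  into the disc of radius \<open>1 - \<delta>\<close>. Shrinking the disc of radius \<open>\<mu>\<close> by the factor \<open>1 - \<delta>\<close> makes it disjoint from the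
  sectors, and still leaves the total area too large.\<close>

lemma exists_almost_normal_norm_ge:
  assumes r: "0 < r" "0 < \<mu>" "\<mu>\<^sup>2 + r\<^sup>2 = 1" and \<delta>: "0 < \<delta>" "\<delta> < 1 - \<mu>"
  shows "\<exists>a u. norm (T a) = 1 \<and> norm (T u) = 1 \<and> almost_normal \<delta> a u \<and>
    1 - \<delta> \<le> norm (T (\<mu> *\<^sub>R a + r *\<^sub>R u))"
proof (rule ccontr)
  assume none: "\<not> ?thesis"
  obtain V where V: "finite V" "V \<noteq> {}" "\<And>a. a \<in> V \<Longrightarrow> norm (T a) = 1"
    "\<And>b. norm (T b) = 1 \<Longrightarrow> \<exists>a\<in>V. norm (T (b - a)) < \<delta>"
    using finite_net_exists[OF \<delta>(1)] by metis
  have near: "norm (T (\<mu> *\<^sub>R a + r *\<^sub>R u)) \<le> 1 - \<delta>"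
    if "a \<in> V" "u \<in> normal_cone V a" "norm (T u) = 1" for a u
  proof -
    have "u \<noteq> 0" using that(3) by (auto simp: T_simps)
    then have "almost_normal \<delta> a u" using almost_normal_net[OF V(4)] that \<delta> r by simp
    then show ?thesis using none V(3) that by (meson not_le less_imp_le)
  qed
  define F where "F = moved_sectors V \<mu> (disc r)"
  define \<rho> where "\<rho> = \<mu> * (1 - \<delta>)"
  have pos: "0 < 1 - \<delta>" using r \<delta> by simp
  have \<rho>: "0 < \<rho>" "\<rho> < 1 - \<delta>" "\<rho> < \<mu>" using r \<delta> by (auto simp: \<rho>_def)
  have F_split: "\<exists>a\<in>V. \<exists>w\<in>disc r \<inter> normal_cone V a. z = \<mu> *\<^sub>R a + w" if "z \<in> F" for z
    using that by (auto simp: F_def moved_sectors_def)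
  have inside: "disc \<rho> \<union> F \<subseteq> disc (1 - \<delta>)"
  proof (rule Un_least)
    show "disc \<rho> \<subseteq> disc (1 - \<delta>)" using \<rho> by (auto simp: disc_def)
    show "F \<subseteq> disc (1 - \<delta>)"
    proof
      fix z assume "z \<in> F"
      then obtain a w where a: "a \<in> V" and w: "w \<in> disc r" "w \<in> normal_cone V a" "z = \<mu> *\<^sub>R a + w"
        using F_split by blast
      show "z \<in> disc (1 - \<delta>)"
      proof (cases "w = 0")
        case True
        then show ?thesis using w V(3)[OF a] r \<delta> by (simp add: disc_def T_simps)
      next
        case False
        define s where "s = norm (T w)"
        define u where "u = (1 / s) *\<^sub>R w"
        have s: "0 < s" "s \<le> r" using w(1) False by (auto simp: s_def disc_def)
        have u: "u \<in> normal_cone V a" "norm (T u) = 1"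
          using w(2) s by (auto simp: u_def s_def T_simps intro!: normal_cone_scaleR)
        have "z = \<mu> *\<^sub>R a + s *\<^sub>R u" using s w by (simp add: u_def)
        moreover have "norm (T (\<mu> *\<^sub>R a) + s *\<^sub>R T u) \<le> 1 - \<delta>"
          using V(3)[OF a] near[OF a u] r s \<delta>
          by (intro norm_le_on_segment[of s r]) (auto simp: T_simps)
        ultimately show ?thesis by (simp add: disc_def T_simps)
      qed
    qed
  qed
  have disj: "disc \<rho> \<inter> F = {}"
  proof (rule ccontr)
    assume "disc \<rho> \<inter> F \<noteq> {}"
    then obtain z a w where z: "norm (T z) \<le> \<rho>" and a: "a \<in> V"
      and w: "w \<in> normal_cone V a" "z = \<mu> *\<^sub>R a + w"
      using F_split by (force simp: disc_def)
    have "w \<noteq> 0" using z V(3)[OF a] w \<rho> r by (auto simp: T_simps)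
    have "norm (T ((1 / \<mu>) *\<^sub>R z)) \<le> 1 - \<delta>"
      using z r by (simp add: \<rho>_def T_simps field_simps)
    then have "area_form ((1 / \<mu>) *\<^sub>R z) w < area_form a w"
      using normal_cone_net[OF V(4) \<open>w \<noteq> 0\<close> w(1)] by blast
    moreover have "area_form z w = \<mu> * area_form a w"
      by (simp add: w(2) area_form_simps(1,3))
    ultimately show False using r by (simp add: area_form_simps(3))
  qed
  have F: "F \<in> lmeasurable" "measure lebesgue F = measure lebesgue (disc r)"
    unfolding F_def by (intro measure_moved_sectors V compact_disc)+
  have "measure lebesgue (disc \<rho>) + measure lebesgue F = measure lebesgue (disc \<rho> \<union> F)"
    using lmeasurable_compact[OF compact_disc] F disj measure_Un3[of "disc \<rho>" lebesgue F] by simp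
  also have "\<dots> \<le> measure lebesgue (disc (1 - \<delta>))"
    using lmeasurable_compact[OF compact_disc] F inside
    by (intro measure_mono_fmeasurable) (auto simp: fmeasurableD)
  finally have "(\<rho>\<^sup>2 + r\<^sup>2) * measure lebesgue (disc 1) \<le> (1 - \<delta>)\<^sup>2 * measure lebesgue (disc 1)"
    unfolding F(2) measure_disc[OF \<rho>(1)] measure_disc[OF r(1)] measure_disc[OF pos] distrib_right .
  then have "\<rho>\<^sup>2 + r\<^sup>2 \<le> (1 - \<delta>)\<^sup>2" using measure_disc_pos mult_le_cancel_right_pos by blast
  moreover have "(1 - \<delta>)\<^sup>2 * r\<^sup>2 < 1 * r\<^sup>2"
    using r \<delta> by (intro mult_strict_right_mono) (auto simp: abs_square_less_1)
  moreover have "(1 - \<delta>)\<^sup>2 = \<rho>\<^sup>2 + (1 - \<delta>)\<^sup>2 * r\<^sup>2"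
  proof -
    have "(1 - \<delta>)\<^sup>2 = (1 - \<delta>)\<^sup>2 * (\<mu>\<^sup>2 + r\<^sup>2)" using r(3) by simp
    then show ?thesis by (simp only: \<rho>_def power_mult_distrib distrib_left mult.commute)
  qed
  ultimately show False by simp
qed

lemma normal_imp_birkhoff:
  assumes a: "norm (T a) = 1" and u: "u \<noteq> 0" "almost_normal 0 a u"
  shows "1 \<le> norm (T a + t *\<^sub>R T u)"
proof (rule ccontr)
  assume less: "\<not> ?thesis"
  define c where "c = a + t *\<^sub>R u"
  define s where "s = norm (T c)"
  have s: "s < 1" using less by (simp add: s_def c_def T_simps)
  have eq: "area_form c u = area_form a u" by (simp add: c_def area_form_simps(1,3))
  obtain b where b: "norm (T b) = 1" "0 < area_form b u" using area_form_support[OF u(1)] by metis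
  then have "area_form b u \<le> area_form a u" using u(2) by (simp add: almost_normal_def disc_def)
  then have pos: "0 < area_form a u" using b(2) by linarith
  then have "c \<noteq> 0" using eq by (auto simp: area_form_simps)
  then have "0 < s" by (simp add: s_def)
  then have "(1 / s) *\<^sub>R c \<in> disc 1" by (simp add: disc_def T_simps s_def[symmetric])
  then have "area_form ((1 / s) *\<^sub>R c) u \<le> area_form a u"
    using u(2) by (auto simp: almost_normal_def)
  then show False using s \<open>0 < s\<close> pos by (simp add: area_form_simps(3) eq field_simps)
qed

text \<open>The sign \<open>\<sigma> = 1\<close> or \<open>\<sigma> = - 1\<close> lets one compactness argument serve both inequalities.\<close>

lemma birkhoff_pair_limit:
  assumes \<delta>0: "0 < \<delta>0"
    and approx: "\<And>\<delta>. 0 < \<delta> \<Longrightarrow> \<delta> < \<delta>0 \<Longrightarrow> \<exists>a u. norm (T a) = 1 \<and> norm (T u) = 1 \<and>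
      almost_normal \<delta> a u \<and> \<sigma> * (norm (T (\<mu> *\<^sub>R a + r *\<^sub>R u)) - 1) \<le> \<delta>"
  shows "\<exists>a u. norm (T a) = 1 \<and> norm (T u) = 1 \<and> (\<forall>t. 1 \<le> norm (T a + t *\<^sub>R T u)) \<and>
    \<sigma> * (norm (\<mu> *\<^sub>R T a + r *\<^sub>R T u) - 1) \<le> 0"
proof -
  define d where "d n = \<delta>0 / real (n + 2)" for n
  have d: "0 < d n" "d n < \<delta>0" for n using \<delta>0 by (auto simp: d_def field_simps intro: add_pos_nonneg)
  have d_lim: "d \<longlonglongrightarrow> 0"
    unfolding d_def by (rule LIMSEQ_ignore_initial_segment[OF lim_const_over_n])
  have "\<exists>p. norm (T (fst p)) = 1 \<and> norm (T (snd p)) = 1 \<and> almost_normal (d n) (fst p) (snd p) \<and>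
      \<sigma> * (norm (T (\<mu> *\<^sub>R fst p + r *\<^sub>R snd p)) - 1) \<le> d n" for n
    using approx[OF d, of n] by auto
  then obtain p where p: "norm (T (fst (p n))) = 1" "norm (T (snd (p n))) = 1"
    "almost_normal (d n) (fst (p n)) (snd (p n))"
    "\<sigma> * (norm (T (\<mu> *\<^sub>R fst (p n) + r *\<^sub>R snd (p n))) - 1) \<le> d n" for n
    by metis
  have "compact (disc 1 \<times> disc 1)" by (intro compact_Times compact_disc)
  moreover have "\<forall>n. p n \<in> disc 1 \<times> disc 1" using p by (auto simp: disc_def mem_Times_iff)
  ultimately obtain l h where h: "strict_mono h" "(p \<circ> h) \<longlonglongrightarrow> l"
    unfolding compact_def by metis
  define a u where "a = fst l" and "u = snd l"
  have a_lim: "(\<lambda>n. fst (p (h n))) \<longlonglongrightarrow> a" and u_lim: "(\<lambda>n. snd (p (h n))) \<longlonglongrightarrow> u"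
    using tendsto_fst[OF h(2)] tendsto_snd[OF h(2)] by (auto simp: a_def u_def o_def)
  have dh_lim: "(\<lambda>n. d (h n)) \<longlonglongrightarrow> 0"
    using LIMSEQ_subseq_LIMSEQ[OF d_lim h(1)] by (simp add: o_def)
  have T_lim: "(\<lambda>n. T (f n)) \<longlonglongrightarrow> T x" if "f \<longlonglongrightarrow> x" for f and x
    using linear that by (simp add: bounded_linear.tendsto linear_linear)
  have area_lim: "(\<lambda>n. area_form (f n) (g n)) \<longlonglongrightarrow> area_form x y"
    if "f \<longlonglongrightarrow> x" "g \<longlonglongrightarrow> y" for f g x y
    unfolding area_form_def by (intro tendsto_intros that)
  have a1: "norm (T a) = 1"
    using LIMSEQ_unique[OF tendsto_norm[OF T_lim[OF a_lim]]] p(1) by simp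
  have u1: "norm (T u) = 1"
    using LIMSEQ_unique[OF tendsto_norm[OF T_lim[OF u_lim]]] p(2) by simp
  have "almost_normal 0 a u"
    unfolding almost_normal_def
  proof
    fix b assume b: "b \<in> disc 1"
    show "(1 - 0) * area_form b u \<le> area_form a u"
    proof (rule LIMSEQ_le)
      show "(\<lambda>n. (1 - d (h n)) * area_form b (snd (p (h n)))) \<longlonglongrightarrow> (1 - 0) * area_form b u"
        by (intro tendsto_intros dh_lim area_lim u_lim)
      show "(\<lambda>n. area_form (fst (p (h n))) (snd (p (h n)))) \<longlonglongrightarrow> area_form a u"
        by (intro area_lim a_lim u_lim)
    qed (use p(3) b in \<open>auto simp: almost_normal_def\<close>)
  qed
  moreover have "u \<noteq> 0" using u1 by (auto simp: T_simps)
  ultimately have birkhoff: "1 \<le> norm (T a + t *\<^sub>R T u)" for t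
    using normal_imp_birkhoff[OF a1] by blast
  have "\<sigma> * (norm (T (\<mu> *\<^sub>R a + r *\<^sub>R u)) - 1) \<le> 0"
  proof (rule LIMSEQ_le)
    show "(\<lambda>n. \<sigma> * (norm (T (\<mu> *\<^sub>R fst (p (h n)) + r *\<^sub>R snd (p (h n)))) - 1))
        \<longlonglongrightarrow> \<sigma> * (norm (T (\<mu> *\<^sub>R a + r *\<^sub>R u)) - 1)"
      by (intro tendsto_intros T_lim a_lim u_lim)
    show "(\<lambda>n. d (h n)) \<longlonglongrightarrow> 0" by (rule dh_lim)
  qed (use p(4) in auto)
  then have "\<sigma> * (norm (\<mu> *\<^sub>R T a + r *\<^sub>R T u) - 1) \<le> 0" by (simp add: T_simps)
  then show ?thesis using a1 u1 birkhoff by blast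
qed

lemma exists_pair_in_plane_norm_le:
  assumes r: "0 < r" "0 < \<mu>" "\<mu>\<^sup>2 + r\<^sup>2 = 1"
  shows "\<exists>a u. norm (T a) = 1 \<and> norm (T u) = 1 \<and> (\<forall>t. 1 \<le> norm (T a + t *\<^sub>R T u)) \<and>
    norm (\<mu> *\<^sub>R T a + r *\<^sub>R T u) \<le> 1"
proof -
  have "\<exists>a u. norm (T a) = 1 \<and> norm (T u) = 1 \<and> almost_normal \<delta> a u \<and>
      1 * (norm (T (\<mu> *\<^sub>R a + r *\<^sub>R u)) - 1) \<le> \<delta>" if \<delta>: "0 < \<delta>" "\<delta> < 1" for \<delta>
    using exists_almost_normal_norm_le[OF r \<delta>] by (simp add: algebra_simps)
  from birkhoff_pair_limit[OF zero_less_one this] obtain a u where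
    au: "norm (T a) = 1" "norm (T u) = 1" "\<forall>t. 1 \<le> norm (T a + t *\<^sub>R T u)"
    "1 * (norm (\<mu> *\<^sub>R T a + r *\<^sub>R T u) - 1) \<le> 0"
    by blast
  from au(4) have "norm (\<mu> *\<^sub>R T a + r *\<^sub>R T u) \<le> 1" by simp
  then show ?thesis using au by blast
qed

lemma exists_pair_in_plane_norm_ge:
  assumes r: "0 < r" "0 < \<mu>" "\<mu>\<^sup>2 + r\<^sup>2 = 1"
  shows "\<exists>a u. norm (T a) = 1 \<and> norm (T u) = 1 \<and> (\<forall>t. 1 \<le> norm (T a + t *\<^sub>R T u)) \<and>
    1 \<le> norm (\<mu> *\<^sub>R T a + r *\<^sub>R T u)"
proof -
  have \<mu>: "0 < 1 - \<mu>" using r by (smt (verit) one_le_power zero_less_power)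
  have "\<exists>a u. norm (T a) = 1 \<and> norm (T u) = 1 \<and> almost_normal \<delta> a u \<and>
      - 1 * (norm (T (\<mu> *\<^sub>R a + r *\<^sub>R u)) - 1) \<le> \<delta>" if \<delta>: "0 < \<delta>" "\<delta> < 1 - \<mu>" for \<delta>
    using exists_almost_normal_norm_ge[OF r \<delta>] by (simp add: algebra_simps)
  from birkhoff_pair_limit[OF \<mu> this] obtain a u where
    au: "norm (T a) = 1" "norm (T u) = 1" "\<forall>t. 1 \<le> norm (T a + t *\<^sub>R T u)"
    "- 1 * (norm (\<mu> *\<^sub>R T a + r *\<^sub>R T u) - 1) \<le> 0"
    by blast
  from au(4) have "1 \<le> norm (\<mu> *\<^sub>R T a + r *\<^sub>R T u)" by simp
  then show ?thesis using au by blast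
qed

end

lemma exists_independent_pair:
  assumes "dim_ge_2 TYPE('a::real_vector)"
  obtains u v :: "'a::real_vector" where "u \<noteq> v" "independent {u, v}"
  using assms by (auto simp: dim_ge_2_def card_2_iff)

lemma exists_normed_plane:
  assumes "dim_ge_2 TYPE('a::real_normed_vector)"
  obtains T :: "complex \<Rightarrow> 'a::real_normed_vector" where "normed_plane T"
proof -
  obtain u v :: 'a where uv: "u \<noteq> v" "independent {u, v}"
    using exists_independent_pair[OF assms] by metis
  define T where "T z = Re z *\<^sub>R u + Im z *\<^sub>R v" for z
  have lin: "linear T" by (rule linearI) (simp_all add: T_def algebra_simps)
  have "z = 0" if "T z = 0" for z
  proof (rule complex_eqI)
    have "Re z = 0 \<and> Im z = 0"
    proof (rule ccontr)
      assume "\<not> ?thesis"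
      then have "dependent {u, v}"
        using that uv(1) by (subst dependent_finite)
          (auto simp: T_def intro!: exI[of _ "\<lambda>w. if w = u then Re z else Im z"])
      then show False using uv(2) by simp
    qed
    then show "Re z = Re 0" "Im z = Im 0" by auto
  qed
  then have "inj T" using linear_injective_0[OF lin] by blast
  then show ?thesis using that lin by (simp add: normed_plane_def)
qed

lemma exists_birkhoff_pair_norm_le:
  assumes dim: "dim_ge_2 TYPE('a::real_normed_vector)" and r: "0 \<le> r" "r \<le> 1"
  obtains x y :: "'a::real_normed_vector" where "birkhoff_pair x y" "norm (sqrt (1 - r\<^sup>2) *\<^sub>R x + r *\<^sub>R y) \<le> 1"
proof -
  obtain T :: "complex \<Rightarrow> 'a" where "normed_plane T" using exists_normed_plane[OF dim] .
  then interpret normed_plane T .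
  show ?thesis
  proof (cases "r = 0 \<or> r = 1")
    case True
    \<comment> \<open>at the endpoints every pair works; the radius \<open>3/5\<close> only serves to produce one\<close>
    obtain a u where "birkhoff_pair (T a) (T u)"
      using exists_pair_in_plane_norm_le[of "3/5" "4/5"] by (auto simp: power2_eq_square birkhoff_pair_def)
    then show ?thesis using that[of "T a" "T u"] True birkhoff_pair_norm[of "T a" "T u"] by auto
  next
    case False
    then have "0 < r" "r\<^sup>2 < 1" using r by (auto simp: abs_square_less_1)
    then show ?thesis
      using exists_pair_in_plane_norm_le[of r "sqrt (1 - r\<^sup>2)"] that by (auto simp: birkhoff_pair_def)
  qed
qed

lemma exists_birkhoff_pair_norm_ge:
  assumes dim: "dim_ge_2 TYPE('a::real_normed_vector)" and r: "0 \<le> r" "r < 1"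
  obtains x y :: "'a::real_normed_vector" where "birkhoff_pair x y" "1 \<le> norm (sqrt (1 - r\<^sup>2) *\<^sub>R x + r *\<^sub>R y)"
proof (cases "r = 0")
  case True
  obtain x y :: 'a where "birkhoff_pair x y" by (rule exists_birkhoff_pair_norm_le[OF dim, of 0]) auto
  then show ?thesis using that[of x y] True birkhoff_pair_norm[of x y] by simp
next
  case False
  obtain T :: "complex \<Rightarrow> 'a" where "normed_plane T" using exists_normed_plane[OF dim] .
  then interpret normed_plane T .
  have "0 < r" "r\<^sup>2 < 1" using False r by (auto simp: abs_square_less_1)
  then show ?thesis
    using exists_pair_in_plane_norm_ge[of r "sqrt (1 - r\<^sup>2)"] that by (auto simp: birkhoff_pair_def)
qed

section \<open>Euclidean planes and inner products\<close>

text \<open>Polar coordinates in the plane of a pair; the signs of the coordinates are absorbed into the pair.\<close>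

lemma birkhoff_pair_polar:
  fixes x y :: "'a::real_normed_vector"
  assumes xy: "birkhoff_pair x y"
  obtains x' y' :: 'a and r where "birkhoff_pair x' y'" "0 \<le> r" "r \<le> 1"
    "norm (\<alpha> *\<^sub>R x + \<beta> *\<^sub>R y) = sqrt (\<alpha>\<^sup>2 + \<beta>\<^sup>2) * norm (sqrt (1 - r\<^sup>2) *\<^sub>R x' + r *\<^sub>R y')"
proof -
  define x' where "x' = (if 0 \<le> \<alpha> then x else - x)"
  define y' where "y' = (if 0 \<le> \<beta> then y else - y)"
  have pair: "birkhoff_pair x' y'"
    using xy by (auto simp: x'_def y'_def intro: birkhoff_pair_uminus_left birkhoff_pair_uminus_right)
  have eq: "\<alpha> *\<^sub>R x + \<beta> *\<^sub>R y = \<bar>\<alpha>\<bar> *\<^sub>R x' + \<bar>\<beta>\<bar> *\<^sub>R y'" by (auto simp: x'_def y'_def)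
  define s where "s = sqrt (\<alpha>\<^sup>2 + \<beta>\<^sup>2)"
  show ?thesis
  proof (cases "s = 0")
    case True
    then show ?thesis using that[OF pair, of 0] by (auto simp: s_def)
  next
    case False
    then have s: "0 < s" by (simp add: s_def less_le)
    have s2: "s\<^sup>2 = \<alpha>\<^sup>2 + \<beta>\<^sup>2" by (simp add: s_def)
    define r where "r = \<bar>\<beta>\<bar> / s"
    have "\<alpha>\<^sup>2 = s\<^sup>2 - \<beta>\<^sup>2" using s2 by simp
    then have "1 - r\<^sup>2 = (\<bar>\<alpha>\<bar> / s)\<^sup>2" using s by (simp add: r_def power_divide diff_divide_distrib)
    then have sq: "sqrt (1 - r\<^sup>2) = \<bar>\<alpha>\<bar> / s" using s by simp
    have "\<bar>\<beta>\<bar> \<le> s" unfolding s_def by (rule real_le_rsqrt) simp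
    then have r: "0 \<le> r" "r \<le> 1" using s by (auto simp: r_def)
    have "\<bar>\<alpha>\<bar> *\<^sub>R x' + \<bar>\<beta>\<bar> *\<^sub>R y' = s *\<^sub>R (sqrt (1 - r\<^sup>2) *\<^sub>R x' + r *\<^sub>R y')"
      unfolding sq using s by (simp add: r_def scaleR_add_right)
    then show ?thesis using that[OF pair r] s eq by (simp add: s_def[symmetric])
  qed
qed

lemma exists_birkhoff_pair_in_plane:
  assumes xy: "birkhoff_pair x y" and w: "w = \<gamma> *\<^sub>R x + \<delta> *\<^sub>R y" "norm w = 1"
  obtains \<alpha> \<beta> where "birkhoff_pair (\<alpha> *\<^sub>R x + \<beta> *\<^sub>R y) w"
proof (cases "\<delta> = 0")
  case False
  have "x \<noteq> t *\<^sub>R w" for t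
  proof
    assume "x = t *\<^sub>R w"
    then have "(1 - t * \<gamma>) *\<^sub>R x + (- (t * \<delta>)) *\<^sub>R y = 0" by (simp add: w(1) algebra_simps)
    from birkhoff_pair_independent[OF xy this] show False using False by auto
  qed
  then obtain t m where "birkhoff_pair ((1 / m) *\<^sub>R (x + t *\<^sub>R w)) w"
    using exists_birkhoff_pair_over[OF w(2)] by metis
  moreover have "(1 / m) *\<^sub>R (x + t *\<^sub>R w) = ((1 + t * \<gamma>) / m) *\<^sub>R x + (t * \<delta> / m) *\<^sub>R y"
    by (simp add: w(1) algebra_simps add_divide_distrib)
  ultimately show ?thesis using that by metis
next
  case True
  have "y \<noteq> t *\<^sub>R w" for t
  proof
    assume "y = t *\<^sub>R w"
    then have "(- (t * \<gamma>)) *\<^sub>R x + 1 *\<^sub>R y = 0" by (simp add: w(1) True)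
    from birkhoff_pair_independent[OF xy this] show False by simp
  qed
  then obtain t m where "birkhoff_pair ((1 / m) *\<^sub>R (y + t *\<^sub>R w)) w"
    using exists_birkhoff_pair_over[OF w(2)] by metis
  moreover have "(1 / m) *\<^sub>R (y + t *\<^sub>R w) = (t * \<gamma> / m) *\<^sub>R x + (1 / m) *\<^sub>R y"
    by (simp add: w(1) True algebra_simps)
  ultimately show ?thesis using that by metis
qed

lemma birkhoff_pair_change_of_basis:
  assumes xy: "birkhoff_pair x y" and w: "birkhoff_pair (\<alpha> *\<^sub>R x + \<beta> *\<^sub>R y) (\<gamma> *\<^sub>R x + \<delta> *\<^sub>R y)"
    (is "birkhoff_pair ?v ?w")
  defines "D \<equiv> \<alpha> * \<delta> - \<beta> * \<gamma>"
  shows "D \<noteq> 0"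
    and "x = (\<delta> / D) *\<^sub>R ?v + (- \<beta> / D) *\<^sub>R ?w"
    and "y = (- \<gamma> / D) *\<^sub>R ?v + (\<alpha> / D) *\<^sub>R ?w"
proof -
  show D: "D \<noteq> 0"
  proof
    assume "D = 0"
    then have "\<delta> *\<^sub>R ?v + (- \<beta>) *\<^sub>R ?w = 0" "(- \<gamma>) *\<^sub>R ?v + \<alpha> *\<^sub>R ?w = 0"
      by (simp_all add: D_def algebra_simps flip: scaleR_add_left scaleR_diff_left)
    from birkhoff_pair_independent[OF w this(1)] birkhoff_pair_independent[OF w this(2)]
    show False using birkhoff_pair_norm[OF w] by simp
  qed
  have "D *\<^sub>R x = \<delta> *\<^sub>R ?v + (- \<beta>) *\<^sub>R ?w" "D *\<^sub>R y = (- \<gamma>) *\<^sub>R ?v + \<alpha> *\<^sub>R ?w"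
    by (simp_all add: D_def algebra_simps)
  then have "(1 / D) *\<^sub>R D *\<^sub>R x = (1 / D) *\<^sub>R (\<delta> *\<^sub>R ?v + (- \<beta>) *\<^sub>R ?w)"
    "(1 / D) *\<^sub>R D *\<^sub>R y = (1 / D) *\<^sub>R ((- \<gamma>) *\<^sub>R ?v + \<alpha> *\<^sub>R ?w)" by simp_all
  then show "x = (\<delta> / D) *\<^sub>R ?v + (- \<beta> / D) *\<^sub>R ?w" "y = (- \<gamma> / D) *\<^sub>R ?v + (\<alpha> / D) *\<^sub>R ?w"
    using D by (simp_all add: scaleR_add_right scaleR_diff_right)
qed

text \<open>Let \<open>D\<close> be the determinant of the second pair in the coordinates of the first, and \<open>A\<close>, \<open>C\<close> the sums of squares of
  its rows, which are at most \<open>1\<close>. Hadamard's inequality gives \<open>D\<^sup>2 \<le> A C\<close>. Reading the first pair in the coordinates of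
  the second gives \<open>A + C \<le> 2 D\<^sup>2\<close>, and \<open>A + C \<le> 2 A C\<close> with \<open>A, C \<le> 1\<close> leaves only \<open>A = C = 1\<close>.\<close>

lemma sum_squares_eq_1_if_norm_ge:
  fixes x y :: "'a::real_normed_vector"
  assumes ge: "\<And>x y a b. birkhoff_pair (x::'a) y \<Longrightarrow> a\<^sup>2 + b\<^sup>2 \<le> (norm (a *\<^sub>R x + b *\<^sub>R y))\<^sup>2"
    and xy: "birkhoff_pair x y" and vw: "birkhoff_pair (\<alpha> *\<^sub>R x + \<beta> *\<^sub>R y) (\<gamma> *\<^sub>R x + \<delta> *\<^sub>R y)"
  shows "\<gamma>\<^sup>2 + \<delta>\<^sup>2 = 1"
proof -
  define D where "D = \<alpha> * \<delta> - \<beta> * \<gamma>"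
  note basis = birkhoff_pair_change_of_basis[OF xy vw, folded D_def]
  define A where "A = \<alpha>\<^sup>2 + \<beta>\<^sup>2"
  define C where "C = \<gamma>\<^sup>2 + \<delta>\<^sup>2"
  have A: "0 \<le> A" "A \<le> 1" and C: "0 \<le> C" "C \<le> 1"
    using ge[OF xy, of \<alpha> \<beta>] ge[OF xy, of \<gamma> \<delta>] birkhoff_pair_norm[OF vw] by (simp_all add: A_def C_def)
  have D2: "0 < D\<^sup>2" using basis(1) by simp
  have "(\<delta> / D)\<^sup>2 + (- \<beta> / D)\<^sup>2 \<le> 1" "(- \<gamma> / D)\<^sup>2 + (\<alpha> / D)\<^sup>2 \<le> 1"
    using ge[OF vw, of "\<delta> / D" "- \<beta> / D"] ge[OF vw, of "- \<gamma> / D" "\<alpha> / D"]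
    unfolding basis(2,3)[symmetric] birkhoff_pair_norm[OF xy] by simp_all
  then have "\<delta>\<^sup>2 + \<beta>\<^sup>2 \<le> D\<^sup>2" "\<gamma>\<^sup>2 + \<alpha>\<^sup>2 \<le> D\<^sup>2"
    using D2 by (simp_all add: power_divide flip: add_divide_distrib)
  then have "A + C \<le> 2 * D\<^sup>2" by (simp add: A_def C_def)
  moreover have "D\<^sup>2 + (\<alpha> * \<gamma> + \<beta> * \<delta>)\<^sup>2 = A * C"
    unfolding D_def A_def C_def by algebra
  then have "D\<^sup>2 \<le> A * C" using zero_le_power2[of "\<alpha> * \<gamma> + \<beta> * \<delta>"] by linarith
  moreover have "A * C \<le> A" "A * C \<le> C"
    using A C by (simp_all add: mult_left_le mult_left_le_one_le)
  ultimately have "A * C = A" "0 < A" using D2 by linarith+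
  then show ?thesis by (simp add: C_def)
qed

text \<open>The line through the first vector of a pair in the direction of the second one misses the open unit disc, hence also the
  ellipse inside it; so its Euclidean distance from the origin, computed from a determinant, is at least \<open>1\<close>. Using
  this in both coordinate systems closes the chain \<open>1 \<le> \<gamma>\<^sup>2 + \<delta>\<^sup>2 \<le> D\<^sup>2 \<le> \<gamma>\<^sup>2 + \<alpha>\<^sup>2 \<le> 1\<close>.\<close>

lemma sum_squares_eq_1_if_norm_le:
  fixes x y :: "'a::real_normed_vector"
  assumes le: "\<And>x y a b. birkhoff_pair (x::'a) y \<Longrightarrow> (norm (a *\<^sub>R x + b *\<^sub>R y))\<^sup>2 \<le> a\<^sup>2 + b\<^sup>2"
    and xy: "birkhoff_pair x y" and vw: "birkhoff_pair (\<alpha> *\<^sub>R x + \<beta> *\<^sub>R y) (\<gamma> *\<^sub>R x + \<delta> *\<^sub>R y)"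
  shows "\<gamma>\<^sup>2 + \<delta>\<^sup>2 = 1"
proof -
  have line: "c\<^sup>2 + d\<^sup>2 \<le> (a * d - b * c)\<^sup>2"
    if pq: "birkhoff_pair p q" and pair: "birkhoff_pair (a *\<^sub>R p + b *\<^sub>R q) (c *\<^sub>R p + d *\<^sub>R q)"
    for p q :: 'a and a b c d
  proof -
    define C where "C = c\<^sup>2 + d\<^sup>2"
    have "1 \<le> C" using le[OF pq, of c d] birkhoff_pair_norm(2)[OF pair] by (simp add: C_def)
    \<comment> \<open>the foot of the perpendicular from the origin in the Euclidean structure of \<open>p\<close>, \<open>q\<close>\<close>
    define t where "t = - (a * c + b * d) / C"
    have "1 \<le> norm ((a *\<^sub>R p + b *\<^sub>R q) + t *\<^sub>R (c *\<^sub>R p + d *\<^sub>R q))"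
      using pair by (simp add: birkhoff_pair_def)
    also have "(a *\<^sub>R p + b *\<^sub>R q) + t *\<^sub>R (c *\<^sub>R p + d *\<^sub>R q) = (a + t * c) *\<^sub>R p + (b + t * d) *\<^sub>R q"
      by (simp add: algebra_simps)
    finally have "1 \<le> (norm ((a + t * c) *\<^sub>R p + (b + t * d) *\<^sub>R q))\<^sup>2"
      by (simp add: one_le_power)
    also have "\<dots> \<le> (a + t * c)\<^sup>2 + (b + t * d)\<^sup>2" by (rule le[OF pq])
    finally have "1 \<le> (a + t * c)\<^sup>2 + (b + t * d)\<^sup>2" .
    then have "C * 1 \<le> C * ((a + t * c)\<^sup>2 + (b + t * d)\<^sup>2)"
      using \<open>1 \<le> C\<close> by (intro mult_left_mono) auto
    also have "C * ((a + t * c)\<^sup>2 + (b + t * d)\<^sup>2) = (a * d - b * c)\<^sup>2"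
    proof -
      have tC: "t * C = - (a * c + b * d)" using \<open>1 \<le> C\<close> by (simp add: t_def)
      have "C * ((a + t * c)\<^sup>2 + (b + t * d)\<^sup>2)
          = C * (a\<^sup>2 + b\<^sup>2) + 2 * (t * C) * (a * c + b * d) + (t * C)\<^sup>2"
        unfolding C_def by algebra
      also have "\<dots> = (a * d - b * c)\<^sup>2" unfolding tC unfolding C_def by algebra
      finally show ?thesis .
    qed
    finally show ?thesis by (simp add: C_def)
  qed
  define D where "D = \<alpha> * \<delta> - \<beta> * \<gamma>"
  note basis = birkhoff_pair_change_of_basis[OF xy vw, folded D_def]
  have D2: "0 < D\<^sup>2" using basis(1) by simp
  have "1 \<le> \<gamma>\<^sup>2 + \<delta>\<^sup>2" using le[OF xy, of \<gamma> \<delta>] birkhoff_pair_norm[OF vw] by simp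
  moreover have "\<gamma>\<^sup>2 + \<delta>\<^sup>2 \<le> D\<^sup>2" using line[OF xy vw] by (simp add: D_def)
  moreover have "D\<^sup>2 \<le> \<gamma>\<^sup>2 + \<alpha>\<^sup>2"
  proof -
    have "1 \<le> (- \<gamma> / D)\<^sup>2 + (\<alpha> / D)\<^sup>2"
      using le[OF vw, of "- \<gamma> / D" "\<alpha> / D"]
      unfolding basis(3)[symmetric] birkhoff_pair_norm[OF xy] by simp
    then show ?thesis using D2 by (simp add: power_divide flip: add_divide_distrib)
  qed
  moreover have "\<gamma>\<^sup>2 + \<alpha>\<^sup>2 \<le> 1"
  proof -
    have "(- \<gamma> / D)\<^sup>2 + (\<alpha> / D)\<^sup>2 \<le> (\<delta> / D * (\<alpha> / D) - (- \<beta> / D) * (- \<gamma> / D))\<^sup>2"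
      using line[OF vw] xy unfolding basis(2,3)[symmetric] by (metis basis(2,3))
    also have "\<delta> / D * (\<alpha> / D) - (- \<beta> / D) * (- \<gamma> / D) = 1 / D"
      using basis(1) by (simp add: field_simps) (simp add: D_def power2_eq_square algebra_simps)
    finally have "(\<gamma>\<^sup>2 + \<alpha>\<^sup>2) / D\<^sup>2 \<le> 1 / D\<^sup>2" by (simp add: power_divide add_divide_distrib)
    then show ?thesis using D2 by (simp only: divide_le_cancel)
  qed
  ultimately show ?thesis by linarith
qed

lemma norm_eq_sum_squares:
  fixes x y :: "'a::real_normed_vector"
  assumes unit: "\<And>\<alpha> \<beta> \<gamma> \<delta>. birkhoff_pair (\<alpha> *\<^sub>R x + \<beta> *\<^sub>R y) (\<gamma> *\<^sub>R x + \<delta> *\<^sub>R y) \<Longrightarrow> \<gamma>\<^sup>2 + \<delta>\<^sup>2 = 1"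
    and xy: "birkhoff_pair x y"
  shows "(norm (a *\<^sub>R x + b *\<^sub>R y))\<^sup>2 = a\<^sup>2 + b\<^sup>2"
proof (cases "a *\<^sub>R x + b *\<^sub>R y = 0")
  case True
  then show ?thesis using birkhoff_pair_independent[OF xy True] by simp
next
  case False
  define n where "n = norm (a *\<^sub>R x + b *\<^sub>R y)"
  have n: "0 < n" using False by (simp add: n_def)
  define w where "w = (a / n) *\<^sub>R x + (b / n) *\<^sub>R y"
  have "w = (1 / n) *\<^sub>R (a *\<^sub>R x + b *\<^sub>R y)" by (simp add: w_def algebra_simps)
  then have "norm w = 1" using n by (simp add: n_def)
  then obtain \<alpha> \<beta> where "birkhoff_pair (\<alpha> *\<^sub>R x + \<beta> *\<^sub>R y) w"
    using exists_birkhoff_pair_in_plane[OF xy w_def] by blast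
  then have "(a / n)\<^sup>2 + (b / n)\<^sup>2 = 1" unfolding w_def by (rule unit)
  then show ?thesis using n by (simp add: n_def[symmetric] power_divide field_simps)
qed

lemma plane_quadratic_form:
  fixes u v :: "'a::real_normed_vector"
  assumes euclid: "\<And>x y a b. birkhoff_pair (x::'a) y \<Longrightarrow> (norm (a *\<^sub>R x + b *\<^sub>R y))\<^sup>2 = a\<^sup>2 + b\<^sup>2"
  shows "\<exists>a b c. \<forall>s t. (norm (s *\<^sub>R u + t *\<^sub>R v))\<^sup>2 = a * s\<^sup>2 + b * s * t + c * t\<^sup>2"
proof (cases "u = 0")
  case True
  then show ?thesis
    by (intro exI[of _ 0] exI[of _ "(norm v)\<^sup>2"]) (simp add: power_mult_distrib)
next
  case False
  define n where "n = norm u"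
  define w where "w = (1 / n) *\<^sub>R u"
  have n: "0 < n" using False by (simp add: n_def)
  have w: "norm w = 1" "u = n *\<^sub>R w" using n by (auto simp: w_def n_def)
  show ?thesis
  proof (cases "\<exists>k. v = k *\<^sub>R w")
    case True
    then obtain k where k: "v = k *\<^sub>R w" by blast
    have "(norm (s *\<^sub>R u + t *\<^sub>R v))\<^sup>2 = n\<^sup>2 * s\<^sup>2 + (2 * n * k) * s * t + k\<^sup>2 * t\<^sup>2" for s t
    proof -
      have "s *\<^sub>R u + t *\<^sub>R v = (s * n + t * k) *\<^sub>R w" by (simp add: w k algebra_simps)
      then have "norm (s *\<^sub>R u + t *\<^sub>R v) = \<bar>s * n + t * k\<bar>" using w(1) by simp
      then show ?thesis by (simp add: power2_eq_square algebra_simps)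
    qed
    then show ?thesis by blast
  next
    case False
    then obtain p m where m: "m > 0" and pair: "birkhoff_pair ((1 / m) *\<^sub>R (v + p *\<^sub>R w)) w"
      using exists_birkhoff_pair_over[OF w(1), of v] by metis
    define x where "x = (1 / m) *\<^sub>R (v + p *\<^sub>R w)"
    have v: "v = m *\<^sub>R x + (- p) *\<^sub>R w" using m by (simp add: x_def)
    have "(norm (s *\<^sub>R u + t *\<^sub>R v))\<^sup>2
        = n\<^sup>2 * s\<^sup>2 + (- 2 * n * p) * s * t + (m\<^sup>2 + p\<^sup>2) * t\<^sup>2" for s t
    proof -
      have "s *\<^sub>R u + t *\<^sub>R v = (t * m) *\<^sub>R x + (s * n - t * p) *\<^sub>R w"
        by (simp add: w v algebra_simps)
      then have "(norm (s *\<^sub>R u + t *\<^sub>R v))\<^sup>2 = (t * m)\<^sup>2 + (s * n - t * p)\<^sup>2"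
        using euclid[OF pair[folded x_def]] by simp
      then show ?thesis by (simp add: power2_eq_square algebra_simps)
    qed
    then show ?thesis by blast
  qed
qed

text \<open>This is the argument of Jordan and von Neumann. Homogeneity of the polarised form \<open>B\<close>
  involves only two vectors and can be read off from the quadratic form of their plane. Additivity involves three vectors
  and follows from the parallelogram law for \<open>u + z\<close>, \<open>v + z\<close> and for \<open>u - z\<close>, \<open>v - z\<close>.\<close>

theorem is_hilbert_space_if_planes_quadratic:
  assumes quad: "\<And>u v :: 'a::banach. \<exists>a b c. \<forall>s t.
    (norm (s *\<^sub>R u + t *\<^sub>R v))\<^sup>2 = a * s\<^sup>2 + b * s * t + c * t\<^sup>2"
  shows "is_hilbert_space TYPE('a)"
proof -
  define B :: "'a \<Rightarrow> 'a \<Rightarrow> real" where "B u v = ((norm (u + v))\<^sup>2 - (norm (u - v))\<^sup>2) / 4" for u v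
  have comm: "B u v = B v u" for u v
    by (simp add: B_def add.commute norm_minus_commute)
  have self: "B u u = (norm u)\<^sup>2" for u
  proof -
    have "u + u = 2 *\<^sub>R u" by (simp add: scaleR_2)
    then show ?thesis by (simp add: B_def power_mult_distrib)
  qed
  have parallelogram: "(norm (u + v))\<^sup>2 + (norm (u - v))\<^sup>2 = 2 * (norm u)\<^sup>2 + 2 * (norm v)\<^sup>2"
    and scale: "B (k *\<^sub>R u) v = k * B u v" for u v k
  proof -
    obtain a b c where q: "\<And>s t. (norm (s *\<^sub>R u + t *\<^sub>R v))\<^sup>2 = a * s\<^sup>2 + b * s * t + c * t\<^sup>2"
      using quad[of u v] by blast
    show "(norm (u + v))\<^sup>2 + (norm (u - v))\<^sup>2 = 2 * (norm u)\<^sup>2 + 2 * (norm v)\<^sup>2"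
      using q[of 1 1] q[of 1 "- 1"] q[of 1 0] q[of 0 1] by simp
    show "B (k *\<^sub>R u) v = k * B u v"
      using q[of k 1] q[of k "- 1"] q[of 1 1] q[of 1 "- 1"] by (simp add: B_def)
  qed
  have add: "B (u + v) z = B u z + B v z" for u v z
  proof -
    have "B (u + v) (2 *\<^sub>R z) = 2 * B (u + v) z"
      using scale[of 2 z "u + v"] by (simp only: comm)
    moreover have "B (u + v) (2 *\<^sub>R z) = 2 * B u z + 2 * B v z"
    proof -
      have eqs: "(u + z) + (v + z) = u + v + 2 *\<^sub>R z" "(u + z) - (v + z) = u - v"
        "(u - z) + (v - z) = u + v - 2 *\<^sub>R z" "(u - z) - (v - z) = u - v"
        by (simp_all add: scaleR_2)
      have "(p - q) / 4 = 2 * ((c - d) / 4) + 2 * ((e - f) / 4)"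
        if "p + g = 2 * c + 2 * e" "q + g = 2 * d + 2 * f" for p q c d e f g :: real
        using that by (simp add: field_simps)
      from this[OF parallelogram[of "u + z" "v + z", unfolded eqs]
          parallelogram[of "u - z" "v - z", unfolded eqs]]
      show ?thesis unfolding B_def .
    qed
    ultimately show ?thesis by simp
  qed
  have "linear (\<lambda>u. B u z)" for z
    using add scale by (intro linearI) simp_all
  then have "bilinear B" unfolding bilinear_def using comm by (metis (no_types, lifting) ext)
  then have "is_inner_product B"
    using comm by (auto simp: is_inner_product_def self)
  then show ?thesis
    unfolding is_hilbert_space_def by (intro exI[of _ B]) (simp add: self)
qed

section \<open>The moduli\<close>

lemma supp_convexity_modulus_eq:
  "supp_convexity_modulus TYPE('a::real_normed_vector) r = Inf {supp_lambda x y r | x y :: 'a. birkhoff_pair x y}"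
  unfolding supp_convexity_modulus_def birkhoff_pair_iff_quasiorthogonal ..

lemma supp_smoothness_modulus_eq:
  "supp_smoothness_modulus TYPE('a::real_normed_vector) r =
     Sup {supp_lambda x y t | (x :: 'a) y t. birkhoff_pair x y \<and> 0 \<le> t \<and> t \<le> r}"
proof -
  have "(x \<in> sphere 0 1 \<and> y \<in> sphere 0 1 \<and> quasiorthogonal y x \<and> 0 \<le> t \<and> t \<le> r) \<longleftrightarrow>
      (birkhoff_pair x y \<and> 0 \<le> t \<and> t \<le> r)" for x y :: 'a and t
    using birkhoff_pair_iff_quasiorthogonal[of x y] by blast
  then show ?thesis unfolding supp_smoothness_modulus_def by simp
qed

lemma supp_convexity_modulus_le:
  assumes "birkhoff_pair x (y :: 'a::real_normed_vector)" "0 \<le> r" "r \<le> 1"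
  shows "supp_convexity_modulus TYPE('a) r \<le> supp_lambda x y r"
  unfolding supp_convexity_modulus_eq
  using assms by (intro cInf_lower bdd_belowI[of _ 0]) (auto intro: supp_lambda_nonneg)

lemma supp_smoothness_modulus_ge:
  assumes "birkhoff_pair x (y :: 'a::real_normed_vector)" "0 \<le> t" "t \<le> r" "r \<le> 1"
  shows "supp_lambda x y t \<le> supp_smoothness_modulus TYPE('a) r"
  unfolding supp_smoothness_modulus_eq
  using assms by (intro cSup_upper bdd_aboveI[of _ 1]) (auto intro: supp_lambda_le_one)

theorem supp_convexity_modulus_upper_bound:
  assumes dim: "dim_ge_2 TYPE('a::real_normed_vector)" and r: "0 \<le> r" "r \<le> 1"
  shows "supp_convexity_modulus TYPE('a) r \<le> 1 - sqrt (1 - r\<^sup>2)"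
proof -
  obtain x y :: 'a where xy: "birkhoff_pair x y" "norm (sqrt (1 - r\<^sup>2) *\<^sub>R x + r *\<^sub>R y) \<le> 1"
    using exists_birkhoff_pair_norm_le[OF dim r] .
  have "supp_lambda x y r \<le> 1 - sqrt (1 - r\<^sup>2)"
    using xy(2) by (intro supp_lambda_le[OF xy(1) r]) simp
  then show ?thesis using supp_convexity_modulus_le[OF xy(1) r] by linarith
qed

text \<open>The value at \<open>r = 1\<close> is obtained from \<open>t < 1\<close>, since the supremum ranges over all \<open>t \<le> r\<close>.\<close>

theorem supp_smoothness_modulus_lower_bound:
  assumes dim: "dim_ge_2 TYPE('a::real_normed_vector)" and r: "0 \<le> r" "r \<le> 1"
  shows "1 - sqrt (1 - r\<^sup>2) \<le> supp_smoothness_modulus TYPE('a) r"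
proof -
  have below: "1 - sqrt (1 - t\<^sup>2) \<le> supp_smoothness_modulus TYPE('a) r"
    if t: "0 \<le> t" "t < 1" "t \<le> r" for t
  proof -
    obtain x y :: 'a where xy: "birkhoff_pair x y" "1 \<le> norm (sqrt (1 - t\<^sup>2) *\<^sub>R x + t *\<^sub>R y)"
      using exists_birkhoff_pair_norm_ge[OF dim t(1,2)] .
    have "t\<^sup>2 \<le> 1" using t by (simp add: abs_square_le_1)
    then have "1 - sqrt (1 - t\<^sup>2) \<le> supp_lambda x y t"
      using xy(2) by (intro supp_lambda_ge[OF xy(1) t(1,2)]) auto
    then show ?thesis using supp_smoothness_modulus_ge[OF xy(1) t(1,3) r(2)] by linarith
  qed
  show ?thesis
  proof (cases "r < 1")
    case True
    then show ?thesis using below r by simp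
  next
    case False
    then have "r = 1" using r by simp
    have "1 \<le> supp_smoothness_modulus TYPE('a) r + s" if s: "0 < s" for s
    proof -
      \<comment> \<open>\<open>t\<close> is chosen with \<open>sqrt (1 - t\<^sup>2) = m \<le> s\<close>\<close>
      define m where "m = min s 1"
      have m: "0 < m" "m \<le> 1" "m \<le> s" using s by (auto simp: m_def)
      then have m2: "0 < m\<^sup>2" "m\<^sup>2 \<le> 1" by (auto simp: abs_square_le_1)
      have "1 - sqrt (1 - (sqrt (1 - m\<^sup>2))\<^sup>2) \<le> supp_smoothness_modulus TYPE('a) r"
        using m2 \<open>r = 1\<close> by (intro below) auto
      then show ?thesis using m m2 by simp
    qed
    then have "1 \<le> supp_smoothness_modulus TYPE('a) r" by (rule field_le_epsilon)
    then show ?thesis using \<open>r = 1\<close> by simp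
  qed
qed

text \<open>In an inner product space, Birkhoff orthogonality of \<open>x\<close> and \<open>y\<close> means \<open>B x y = 0\<close>: take \<open>t = - B x y\<close>. The rest is the
  theorem of Pythagoras.\<close>

lemma supp_lambda_hilbert:
  assumes B: "is_inner_product B" and norm_B: "\<And>x :: 'h::banach. norm x = sqrt (B x x)"
    and xy: "birkhoff_pair x (y :: 'h)" and r: "0 \<le> r" "r \<le> 1"
  shows "supp_lambda x y r = 1 - sqrt (1 - r\<^sup>2)"
proof -
  have bil: "bilinear B" and comm: "B u v = B v u" for u v
    using B by (auto simp: is_inner_product_def)
  note B_simps = bilinear_ladd[OF bil] bilinear_radd[OF bil] bilinear_lmul[OF bil] bilinear_rmul[OF bil]
  have norm2: "(norm z)\<^sup>2 = B z z" for z
    using B by (simp add: norm_B is_inner_product_def)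
  have expand: "(norm (c *\<^sub>R x + d *\<^sub>R y))\<^sup>2 = c\<^sup>2 + 2 * c * d * B x y + d\<^sup>2" for c d
  proof -
    have "B x x = 1" "B y y = 1" using norm2[of x] norm2[of y] birkhoff_pair_norm[OF xy] by simp_all
    then show ?thesis
      unfolding norm2 by (simp add: B_simps comm[of y x] power2_eq_square algebra_simps)
  qed
  have "B x y = 0"
  proof -
    have "1 \<le> (norm (1 *\<^sub>R x + (- B x y) *\<^sub>R y))\<^sup>2"
      using xy by (intro one_le_power) (simp add: birkhoff_pair_def del: scaleR_minus_left)
    then have "(B x y)\<^sup>2 \<le> 0" unfolding expand by (simp add: power2_eq_square)
    then show ?thesis by simp
  qed
  then have pythagoras: "(norm (c *\<^sub>R x + d *\<^sub>R y))\<^sup>2 = c\<^sup>2 + d\<^sup>2" for c d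
    using expand by simp
  have r2: "r\<^sup>2 \<le> 1" using r by (simp add: abs_square_le_1)
  show ?thesis
  proof (rule antisym)
    have "(norm (sqrt (1 - r\<^sup>2) *\<^sub>R x + r *\<^sub>R y))\<^sup>2 = 1" unfolding pythagoras using r2 by simp
    then have "norm (sqrt (1 - r\<^sup>2) *\<^sub>R x + r *\<^sub>R y) \<le> 1"
      by (metis abs_norm_cancel abs_square_eq_1 order_refl)
    then show "supp_lambda x y r \<le> 1 - sqrt (1 - r\<^sup>2)" by (intro supp_lambda_le[OF xy r]) simp
    have "(1 - supp_lambda x y r)\<^sup>2 + r\<^sup>2 = 1"
      using norm_supp_lambda[OF xy r] pythagoras[of "1 - supp_lambda x y r" r] by simp
    then have "1 - supp_lambda x y r \<le> sqrt (1 - r\<^sup>2)" by (intro real_le_rsqrt) simp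
    then show "1 - sqrt (1 - r\<^sup>2) \<le> supp_lambda x y r" by simp
  qed
qed

lemma one_minus_sqrt_mono: "0 \<le> t \<Longrightarrow> t \<le> r \<Longrightarrow> 1 - sqrt (1 - t\<^sup>2) \<le> 1 - sqrt (1 - r\<^sup>2)"
  by (simp add: power_mono)

theorem moduli_hilbert:
  assumes hilbert: "is_hilbert_space TYPE('h::banach)" and dim: "dim_ge_2 TYPE('h)"
    and r: "0 \<le> r" "r \<le> 1"
  shows "supp_convexity_modulus TYPE('h) r = 1 - sqrt (1 - r\<^sup>2)"
    and "supp_smoothness_modulus TYPE('h) r = 1 - sqrt (1 - r\<^sup>2)"
proof -
  obtain B :: "'h \<Rightarrow> 'h \<Rightarrow> real" where B: "is_inner_product B" "\<And>x. norm x = sqrt (B x x)"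
    using hilbert by (auto simp: is_hilbert_space_def)
  note lam = supp_lambda_hilbert[OF B]
  obtain x y :: 'h where xy: "birkhoff_pair x y" using exists_birkhoff_pair_norm_le[OF dim r] .
  show "supp_convexity_modulus TYPE('h) r = 1 - sqrt (1 - r\<^sup>2)"
    unfolding supp_convexity_modulus_eq
  proof (rule cInf_eq_minimum)
    show "1 - sqrt (1 - r\<^sup>2) \<in> {supp_lambda x y r | x y :: 'h. birkhoff_pair x y}"
      using xy lam[OF xy r, symmetric] by blast
  qed (use lam r in force)
  show "supp_smoothness_modulus TYPE('h) r = 1 - sqrt (1 - r\<^sup>2)"
    unfolding supp_smoothness_modulus_eq
  proof (rule cSup_eq_maximum)
    show "1 - sqrt (1 - r\<^sup>2) \<in> {supp_lambda x y t | (x :: 'h) y t. birkhoff_pair x y \<and> 0 \<le> t \<and> t \<le> r}"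
      using xy lam[OF xy r, symmetric] r by blast
    fix l assume "l \<in> {supp_lambda x y t | (x :: 'h) y t. birkhoff_pair x y \<and> 0 \<le> t \<and> t \<le> r}"
    then obtain x y :: 'h and t where "l = supp_lambda x y t" "birkhoff_pair x y" "0 \<le> t" "t \<le> r" by blast
    then show "l \<le> 1 - sqrt (1 - r\<^sup>2)"
      using lam[of x y t] one_minus_sqrt_mono[of t r] r(2) by simp
  qed
qed

theorem is_hilbert_space_if_modulus_eq:
  assumes "(\<forall>r\<in>{0..1}. supp_convexity_modulus TYPE('a::banach) r = 1 - sqrt (1 - r\<^sup>2))
    \<or> (\<forall>r\<in>{0..1}. supp_smoothness_modulus TYPE('a) r = 1 - sqrt (1 - r\<^sup>2))"
  shows "is_hilbert_space TYPE('a)"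
proof -
  have sq: "0 \<le> sqrt (1 - r\<^sup>2)" if "0 \<le> r" "r \<le> 1" for r :: real
    using that by (simp add: abs_square_le_1)
  have unit: "\<gamma>\<^sup>2 + \<delta>\<^sup>2 = 1"
    if xy: "birkhoff_pair (x::'a) y" and vw: "birkhoff_pair (\<alpha> *\<^sub>R x + \<beta> *\<^sub>R y) (\<gamma> *\<^sub>R x + \<delta> *\<^sub>R y)"
    for x y \<alpha> \<beta> \<gamma> \<delta>
    using assms
  proof
    assume eq: "\<forall>r\<in>{0..1}. supp_convexity_modulus TYPE('a) r = 1 - sqrt (1 - r\<^sup>2)"
    have at_least: "1 \<le> norm (sqrt (1 - r\<^sup>2) *\<^sub>R x + r *\<^sub>R y)"
      if pair: "birkhoff_pair (x::'a) y" and r: "0 \<le> r" "r \<le> 1" for x y r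
    proof (rule ccontr)
      assume less: "\<not> ?thesis"
      then have "supp_lambda x y r \<le> 1 - sqrt (1 - r\<^sup>2)"
        by (intro supp_lambda_le[OF pair r]) simp
      moreover have "1 - sqrt (1 - r\<^sup>2) \<le> supp_lambda x y r"
        using supp_convexity_modulus_le[OF pair r] eq r by simp
      ultimately have "supp_lambda x y r = 1 - sqrt (1 - r\<^sup>2)" by simp
      then show False using norm_supp_lambda[OF pair r] less by simp
    qed
    have "a\<^sup>2 + b\<^sup>2 \<le> (norm (a *\<^sub>R x + b *\<^sub>R y))\<^sup>2" if pair: "birkhoff_pair (x::'a) y" for x y a b
    proof (rule birkhoff_pair_polar[OF pair, of a b])
      fix x' y' :: 'a and r
      assume "birkhoff_pair x' y'" "0 \<le> r" "r \<le> 1" and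
        eq: "norm (a *\<^sub>R x + b *\<^sub>R y) = sqrt (a\<^sup>2 + b\<^sup>2) * norm (sqrt (1 - r\<^sup>2) *\<^sub>R x' + r *\<^sub>R y')"
      then have "1 \<le> (norm (sqrt (1 - r\<^sup>2) *\<^sub>R x' + r *\<^sub>R y'))\<^sup>2"
        using at_least by (intro one_le_power) auto
      then show ?thesis
        unfolding eq power_mult_distrib
        using mult_left_mono[of 1 _ "a\<^sup>2 + b\<^sup>2"] by simp
    qed
    from sum_squares_eq_1_if_norm_ge[OF this xy vw] show ?thesis .
  next
    assume eq: "\<forall>r\<in>{0..1}. supp_smoothness_modulus TYPE('a) r = 1 - sqrt (1 - r\<^sup>2)"
    have at_most: "norm (sqrt (1 - r\<^sup>2) *\<^sub>R x + r *\<^sub>R y) \<le> 1"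
      if pair: "birkhoff_pair (x::'a) y" and r: "0 \<le> r" "r \<le> 1" for x y r
      using supp_smoothness_modulus_ge[OF pair r(1) _ r(2)] eq r sq[OF r]
      by (intro norm_le_one_if_supp_lambda_le[OF pair r]) auto
    have "(norm (a *\<^sub>R x + b *\<^sub>R y))\<^sup>2 \<le> a\<^sup>2 + b\<^sup>2" if pair: "birkhoff_pair (x::'a) y" for x y a b
    proof (rule birkhoff_pair_polar[OF pair, of a b])
      fix x' y' :: 'a and r
      assume "birkhoff_pair x' y'" "0 \<le> r" "r \<le> 1" and
        eq: "norm (a *\<^sub>R x + b *\<^sub>R y) = sqrt (a\<^sup>2 + b\<^sup>2) * norm (sqrt (1 - r\<^sup>2) *\<^sub>R x' + r *\<^sub>R y')"
      then have "(norm (sqrt (1 - r\<^sup>2) *\<^sub>R x' + r *\<^sub>R y'))\<^sup>2 \<le> 1"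
        using at_most by (intro power_le_one) auto
      then show ?thesis
        unfolding eq power_mult_distrib by (simp add: mult_left_le)
    qed
    from sum_squares_eq_1_if_norm_le[OF this xy vw] show ?thesis .
  qed
  have "(norm (a *\<^sub>R x + b *\<^sub>R y))\<^sup>2 = a\<^sup>2 + b\<^sup>2" if xy: "birkhoff_pair (x::'a) y" for x y a b
    using norm_eq_sum_squares[OF unit[OF xy] xy] .
  from is_hilbert_space_if_planes_quadratic[OF plane_quadratic_form[OF this]] show ?thesis .
qed

theorem corollary2:
  assumes "dim_ge_2 TYPE('a::banach)"
  shows "(\<forall>r\<in>{0..1}.
            supp_convexity_modulus TYPE('a) r \<le> 1 - sqrt (1 - r\<^sup>2)
          \<and> 1 - sqrt (1 - r\<^sup>2) \<le> supp_smoothness_modulus TYPE('a) r)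
       \<and> (is_hilbert_space TYPE('h::banach) \<and> dim_ge_2 TYPE('h) \<longrightarrow>
            (\<forall>r\<in>{0..1}.
                1 - sqrt (1 - r\<^sup>2) = supp_convexity_modulus TYPE('h) r
              \<and> 1 - sqrt (1 - r\<^sup>2) = supp_smoothness_modulus TYPE('h) r))
       \<and> ((\<forall>r\<in>{0..1}. supp_convexity_modulus TYPE('a) r = 1 - sqrt (1 - r\<^sup>2))
          \<or> (\<forall>r\<in>{0..1}. supp_smoothness_modulus TYPE('a) r = 1 - sqrt (1 - r\<^sup>2))
          \<longrightarrow> is_hilbert_space TYPE('a))"
proof (intro conjI ballI impI)
  fix r :: real assume r: "r \<in> {0..1}"
  show "supp_convexity_modulus TYPE('a) r \<le> 1 - sqrt (1 - r\<^sup>2)"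
    using supp_convexity_modulus_upper_bound[OF assms] r by simp
  show "1 - sqrt (1 - r\<^sup>2) \<le> supp_smoothness_modulus TYPE('a) r"
    using supp_smoothness_modulus_lower_bound[OF assms] r by simp
next
  fix r :: real assume h: "is_hilbert_space TYPE('h) \<and> dim_ge_2 TYPE('h)" and r: "r \<in> {0..1}"
  show "1 - sqrt (1 - r\<^sup>2) = supp_convexity_modulus TYPE('h) r"
    "1 - sqrt (1 - r\<^sup>2) = supp_smoothness_modulus TYPE('h) r"
    using moduli_hilbert[of r, where 'h = 'h] h r by simp_all
qed (rule is_hilbert_space_if_modulus_eq)

end
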